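(* Let $\mathcal F$ be a coherent sheaf on the weighted projective stack $\mathbb P(\mathbf a)$ and let $\mathbf T(\mathcal F)=\bigoplus_{\ell\in\mathbb Z}\mathbf T(\mathcal F)_\ell$ be its Tate resolution. For every $\ell\in\mathbb Z$, the differential on $\mathbf T(\mathcal F)$ sends $\mathbf T(\mathcal F)_\ell$ to $\mathbf T(\mathcal F)_{\ell-1}\oplus\cdots\oplus\mathbf T(\mathcal F)_{\ell-\sigma-1}$, where $\sigma=\sum_{i=0}^n(a_i-1)$.
   Context: Let $\mathbf k$ be a field and $S=\mathbf k[x_0,\dots,x_n]$ the $\mathbb Z$-graded polynomial ring with $\deg(x_i)=a_i$, $1\le a_0\le\cdots\le a_n$; $\mathfrak m=(x_0,\dots,x_n)$; $a=\sum_i a_i$; $\mathbf a=(a_0,\dots,a_n)$. $M_{\ge r}=\bigoplus_{d\ge r}M_d$. $E=\bigwedge_{\mathbf k}(e_0,\dots,e_n)$ is the exterior algebra, $\mathbb Z^2$-graded by $\deg(e_i)=(-a_i;-1)$. Twists: $N(c;s)_{(d;t)}=N_{(c+d;s+t)}$. $\omega_E=E(-a;-n-1)$. A differential $E$-module is a $\mathbb Z^2$-graded $E$-module $D$ with a degree $(0;-1)$ $E$-linear endomorphism $\partial$ with $\partial^2=0$; morphisms are degree $(0;0)$ $E$-linear maps commuting with differentials; $H(D)=\ker\partial/\operatorname{im}\partial$; a quasi-isomorphism is a morphism inducing an isomorphism on homology. The cone of $f\colon D\to D'$ is $D'\oplus D(0,-1)$ with differential $\begin{pmatrix}\partial'&f\\0&-\partial\end{pmatrix}$.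 $D$ is minimal if the induced differential on $D\otimes_E\mathbf k$ is zero. A free flag is a differential $E$-module $F$ with a decomposition $F=\bigoplus_{i\in\mathbb Z}F_i$ such that each $F_i$ is free, $F_i=0$ for $i\ll0$, and $\partial(F_i)\subseteq\bigoplus_{j<i}F_j$. A minimal free flag resolution of $D$ is a quasi-isomorphism $F\to D$ with $F$ a minimal free flag; for $D$ with finitely generated homology it is known to exist and to be unique up to isomorphism. For a graded $S$-module $M$, $\mathbf R(M)=\bigoplus_{d\in\mathbb Z}M_d\otimes_{\mathbf k}\omega_E(-d;0)$ with differential $\partial(m\otimes f)=\sum_{i=0}^n x_im\otimes e_if$. It is known that $H(\mathbf R(M))$ is finitely generated if $M$ is. Regularity: $M$ is $r$-regular if $H^i_{\mathfrak m}(M)_j=0$ for all $i$ and all $j>r-i$; $\operatorname{reg}(M)=\inf\{r: M\text{ is }r\text{-regular}\}$. $\mathbb P(\mathbf a)=[(\mathbb A^{n+1}\setminus\{0\})/\mathbf k^*]$ is the weighted projective stack for the action $\lambda\cdot(x_0,\dots,x_n)=(\lambda^{a_0}x_0,\dots,\lambda^{a_n}x_n)$. $\operatorname{coh}(\mathbb P(\mathbf a))$ is the quotient of the category of finitely generated graded $S$-modules by the modules of finite $\mathbf k$-dimension; $\widetilde M$ is the sheaf associated to $M$, and $\mathcal F(j)=\mathcal F\otimes\mathcal O(j)$. Tate resolution: for $\mathcal F=\widetilde M$ with $M$ finitely generated and an integer $r>\operatorname{reg}(M)$, $\mathbf T(\mathcal F)=\operatorname{cone}(\varepsilon)$, where $\varepsilon\colon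 F\to\mathbf R(M_{\ge r})$ is a minimal free flag resolution. It is an exact, minimal differential $E$-module, independent up to isomorphism of the choices of $M$ and $r$, and as a graded $E$-module it is isomorphic to $\bigoplus_{i,j}H^i(\mathbb P(\mathbf a),\mathcal F(j))\otimes_{\mathbf k}\omega_E(-j;i)$. One identifies the underlying $E$-module of $\mathbf T(\mathcal F)$ with this direct sum and sets $$\mathbf T(\mathcal F)_\ell:=\bigoplus_{-i-j=\ell}H^i(\mathbb P(\mathbf a),\mathcal F(j))\otimes_{\mathbf k}\omega_E(-j;i).$$ *)

theory Defs
  imports "HOL-Algebra.Module" "HOL-Algebra.AbelCoset"
    "HOL-Library.Poly_Mapping" "HOL-Library.Extended_Real"
begin

section \<open>The polynomial ring and the exterior algebra\<close>

type_synonym 'k mpoly = "(nat \<Rightarrow>\<^sub>0 nat) \<Rightarrow>\<^sub>0 'k"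

definition S_ring :: "nat \<Rightarrow> 'k::field mpoly ring" where
  "S_ring n = \<lparr>carrier = {p. \<forall>m\<in>Poly_Mapping.keys p. Poly_Mapping.keys m \<subseteq> {..n}},
     mult = (*), one = 1, zero = 0, add = (+)\<rparr>"

definition var :: "nat \<Rightarrow> 'k::field mpoly" where
  "var i = Poly_Mapping.single (Poly_Mapping.single i 1) 1"

definition scalar :: "'k::field \<Rightarrow> 'k mpoly" where
  "scalar c = Poly_Mapping.single 0 c"

definition S_deg :: "nat \<Rightarrow> (nat \<Rightarrow> nat) \<Rightarrow> int \<Rightarrow> 'k::field mpoly set" where
  "S_deg n a d = {p \<in> carrier (S_ring n). \<forall>m\<in>Poly_Mapping.keys p.
     int (\<Sum>i\<in>Poly_Mapping.keys m. a i * Poly_Mapping.lookup m i) = d}"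

text \<open>
  The element \<open>f\<close> of the exterior algebra is its family of coordinates: it stands for
  the sum of the \<open>f I \<cdot> e_I\<close> over \<open>I \<subseteq> {0..n}\<close>, where \<open>e_I\<close> is the product of the \<open>e_i\<close>, \<open>i \<in> I\<close>,
  in increasing order.  For disjoint \<open>I\<close>, \<open>J\<close> one has \<open>e_I e_J = esgn I J \<cdot> e_(I \<union> J)\<close>.
\<close>

definition esgn :: "nat set \<Rightarrow> nat set \<Rightarrow> 'k::field" where
  "esgn I J = (- 1) ^ card {(i, j). i \<in> I \<and> j \<in> J \<and> j < i}"

definition E_ring :: "nat \<Rightarrow> (nat set \<Rightarrow> 'k::field) ring" where
  "E_ring n = \<lparr>carrier = {f. \<forall>I. \<not> I \<subseteq> {..n} \<longrightarrow> f I = 0},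
     mult = (\<lambda>f g K. \<Sum>I\<in>Pow K. esgn I (K - I) * f I * g (K - I)),
     one = (\<lambda>K. if K = {} then 1 else 0), zero = (\<lambda>K. 0), add = (\<lambda>f g K. f K + g K)\<rparr>"

definition egen :: "nat \<Rightarrow> nat set \<Rightarrow> 'k::field" where
  "egen i = (\<lambda>K. if K = {i} then 1 else 0)"

definition edeg :: "(nat \<Rightarrow> nat) \<Rightarrow> nat set \<Rightarrow> int \<times> int" where
  "edeg a I = (- (\<Sum>i\<in>I. int (a i)), - int (card I))"

definition E_deg :: "nat \<Rightarrow> (nat \<Rightarrow> nat) \<Rightarrow> int \<times> int \<Rightarrow> (nat set \<Rightarrow> 'k::field) set" where
  "E_deg n a p = {f \<in> carrier (E_ring n). \<forall>I. f I \<noteq> 0 \<longrightarrow> edeg a I = p}"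

definition k_ring :: "'k::field ring" where
  "k_ring = \<lparr>carrier = UNIV, mult = (*), one = 1, zero = 0, add = (+)\<rparr>"


lemma esgn_Un_left:
  assumes "finite I" "finite J" "finite K" "I \<inter> J = {}"
  shows "esgn (I \<union> J) K = esgn I K * (esgn J K :: 'k::field)"
proof -
  let ?C = "\<lambda>I. {(i, j). i \<in> I \<and> j \<in> K \<and> j < i}"
  have fin: "finite (?C I)" "finite (?C J)"
    using assms by (auto intro: finite_subset[of _ "I \<times> K"] finite_subset[of _ "J \<times> K"])
  have "?C (I \<union> J) = ?C I \<union> ?C J" "?C I \<inter> ?C J = {}"
    using assms by auto
  then have "card (?C (I \<union> J)) = card (?C I) + card (?C J)"
    using fin by (simp add: card_Un_disjoint)
  then show ?thesis
    by (simp add: esgn_def power_add)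
qed

lemma esgn_Un_right:
  assumes "finite I" "finite J" "finite K" "J \<inter> K = {}"
  shows "esgn I (J \<union> K) = esgn I J * (esgn I K :: 'k::field)"
proof -
  let ?C = "\<lambda>J. {(i, j). i \<in> I \<and> j \<in> J \<and> j < i}"
  have fin: "finite (?C J)" "finite (?C K)"
    using assms by (auto intro: finite_subset[of _ "I \<times> J"] finite_subset[of _ "I \<times> K"])
  have "?C (J \<union> K) = ?C J \<union> ?C K" "?C J \<inter> ?C K = {}"
    using assms by auto
  then have "card (?C (J \<union> K)) = card (?C J) + card (?C K)"
    using fin by (simp add: card_Un_disjoint)
  then show ?thesis
    by (simp add: esgn_def power_add)
qed

lemma esgn_empty [simp]: "esgn {} K = 1" "esgn I {} = 1"
  by (simp_all add: esgn_def)

lemma E_mult_assoc: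
  fixes f g h :: "nat set \<Rightarrow> 'k::field"
  shows "(f \<otimes>\<^bsub>E_ring n\<^esub> g) \<otimes>\<^bsub>E_ring n\<^esub> h = f \<otimes>\<^bsub>E_ring n\<^esub> (g \<otimes>\<^bsub>E_ring n\<^esub> h)"
proof
  fix K :: "nat set"
  show "((f \<otimes>\<^bsub>E_ring n\<^esub> g) \<otimes>\<^bsub>E_ring n\<^esub> h) K = (f \<otimes>\<^bsub>E_ring n\<^esub> (g \<otimes>\<^bsub>E_ring n\<^esub> h)) K"
  proof (cases "finite K")
    case True
    have fin: "finite I" if "I \<subseteq> K" for I using that True finite_subset by blast
    have "((f \<otimes>\<^bsub>E_ring n\<^esub> g) \<otimes>\<^bsub>E_ring n\<^esub> h) K =
        (\<Sum>L\<in>Pow K. \<Sum>I\<in>Pow L. esgn L (K - L) * esgn I (L - I) * f I * g (L - I) * h (K - L))"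
      by (simp add: E_ring_def sum_distrib_left sum_distrib_right mult_ac)
    also have "\<dots> = (\<Sum>(L, I)\<in>(SIGMA L:Pow K. Pow L). esgn L (K - L) * esgn I (L - I) * f I * g (L - I) * h (K - L))"
      using True fin by (subst sum.Sigma) auto
    also have "\<dots> = (\<Sum>(I, J)\<in>(SIGMA I:Pow K. Pow (K - I)).
        esgn I (K - I) * esgn J (K - I - J) * f I * g J * h (K - I - J))"
    proof (rule sum.reindex_bij_witness[where i = "\<lambda>(I, J). (I \<union> J, I)" and j = "\<lambda>(L, I). (I, L - I)"], goal_cases)
      case (5 x)
      obtain L I where x: "x = (L, I)" by (cases x)
      with 5 have LI: "I \<subseteq> L" "L \<subseteq> K" by auto
      let ?J = "L - I" and ?P = "K - L"
      have e: "K - I = ?J \<union> ?P" "K - I - ?J = ?P" and L: "L = I \<union> ?J" using LI by auto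
      have "esgn L ?P = esgn I ?P * (esgn ?J ?P :: 'k)"
        by (subst L, rule esgn_Un_left) (use LI fin in auto)
      moreover have "esgn I (K - I) = esgn I ?J * (esgn I ?P :: 'k)"
        unfolding e(1) by (rule esgn_Un_right) (use LI fin in auto)
      ultimately show ?case
        by (simp only: x split e(2)) (simp add: mult_ac)
    qed auto
    also have "\<dots> = (\<Sum>I\<in>Pow K. \<Sum>J\<in>Pow (K - I). esgn I (K - I) * esgn J (K - I - J) * f I * g J * h (K - I - J))"
      using True by (subst sum.Sigma) auto
    also have "\<dots> = (f \<otimes>\<^bsub>E_ring n\<^esub> (g \<otimes>\<^bsub>E_ring n\<^esub> h)) K"
      by (simp add: E_ring_def sum_distrib_left sum_distrib_right mult_ac)
    finally show ?thesis .
  qed (simp add: E_ring_def finite_Pow_iff)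
qed

lemma E_mult_one:
  fixes f :: "nat set \<Rightarrow> 'k::field"
  assumes "f \<in> carrier (E_ring n)"
  shows "\<one>\<^bsub>E_ring n\<^esub> \<otimes>\<^bsub>E_ring n\<^esub> f = f" "f \<otimes>\<^bsub>E_ring n\<^esub> \<one>\<^bsub>E_ring n\<^esub> = f"
proof -
  have inf: "f K = 0" if "infinite K" for K
    using assms that finite_subset[of K "{..n}"] by (auto simp: E_ring_def)
  have "(\<one>\<^bsub>E_ring n\<^esub> \<otimes>\<^bsub>E_ring n\<^esub> f) K = f K \<and> (f \<otimes>\<^bsub>E_ring n\<^esub> \<one>\<^bsub>E_ring n\<^esub>) K = f K" for K
  proof (cases "finite K")
    case True
    have "(\<one>\<^bsub>E_ring n\<^esub> \<otimes>\<^bsub>E_ring n\<^esub> f) K = (\<Sum>I\<in>Pow K. if I = {} then f K else 0)"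
      by (auto simp: E_ring_def intro!: sum.cong)
    moreover have "(f \<otimes>\<^bsub>E_ring n\<^esub> \<one>\<^bsub>E_ring n\<^esub>) K = (\<Sum>I\<in>Pow K. if I = K then f K else 0)"
      by (auto simp: E_ring_def intro!: sum.cong)
    ultimately show ?thesis using True by (simp add: sum.delta)
  qed (simp add: E_ring_def inf finite_Pow_iff)
  then show "\<one>\<^bsub>E_ring n\<^esub> \<otimes>\<^bsub>E_ring n\<^esub> f = f" "f \<otimes>\<^bsub>E_ring n\<^esub> \<one>\<^bsub>E_ring n\<^esub> = f" by auto
qed

lemma E_ring_ring: "ring (E_ring n :: (nat set \<Rightarrow> 'k::field) ring)"
proof (rule ringI)
  show "abelian_group (E_ring n :: (nat set \<Rightarrow> 'k) ring)"
  proof (rule abelian_groupI)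
    fix f :: "nat set \<Rightarrow> 'k" assume "f \<in> carrier (E_ring n)"
    then show "\<exists>y\<in>carrier (E_ring n). y \<oplus>\<^bsub>E_ring n\<^esub> f = \<zero>\<^bsub>E_ring n\<^esub>"
      by (intro bexI[of _ "\<lambda>K. - f K"]) (auto simp: E_ring_def)
  qed (auto simp: E_ring_def algebra_simps)
  show "monoid (E_ring n :: (nat set \<Rightarrow> 'k) ring)"
  proof (rule monoidI)
    fix f g :: "nat set \<Rightarrow> 'k" assume fg: "f \<in> carrier (E_ring n)" "g \<in> carrier (E_ring n)"
    show "f \<otimes>\<^bsub>E_ring n\<^esub> g \<in> carrier (E_ring n)"
    proof -
      have "f I * g (K - I) = 0" if "\<not> K \<subseteq> {..n}" "I \<subseteq> K" for I K
      proof -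
        have "\<not> I \<subseteq> {..n} \<or> \<not> K - I \<subseteq> {..n}" using that by auto
        then show ?thesis using fg by (elim disjE) (simp_all add: E_ring_def)
      qed
      then have "(\<Sum>I\<in>Pow K. esgn I (K - I) * f I * g (K - I)) = 0" if "\<not> K \<subseteq> {..n}" for K
        using that by (intro sum.neutral ballI) (simp add: mult.assoc)
      then show ?thesis by (simp add: E_ring_def)
    qed
  qed (auto simp: E_mult_assoc E_mult_one, auto simp: E_ring_def)
qed (auto simp: E_ring_def fun_eq_iff algebra_simps sum.distrib)

lemma egen_mult:
  assumes "i \<le> n" "j \<le> n"
  shows "egen i \<otimes>\<^bsub>E_ring n\<^esub> egen j = (\<lambda>K. if i \<noteq> j \<and> K = {i, j} then (if i < j then 1 else - 1) else (0::'k::field))"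
proof
  fix K
  let ?c = "if i \<noteq> j \<and> K = {i, j} then esgn {i} {j} else (0::'k)"
  have "(egen i \<otimes>\<^bsub>E_ring n\<^esub> egen j) K = (\<Sum>I\<in>Pow K. esgn I (K - I) * egen i I * (egen j (K - I) :: 'k))"
    by (simp add: E_ring_def)
  also have "\<dots> = (\<Sum>I\<in>Pow K. if I = {i} then ?c else 0)"
  proof (rule sum.cong)
    fix I assume "I \<in> Pow K"
    show "esgn I (K - I) * egen i I * egen j (K - I) = (if I = {i} then ?c else 0)"
    proof (cases "I = {i}")
      case True
      with \<open>I \<in> Pow K\<close> have "(K - {i} = {j}) = (i \<noteq> j \<and> K = {i, j})" by blast
      then show ?thesis unfolding True egen_def by (cases "K - {i} = {j}") (simp_all only: if_True if_False refl mult_1_right mult_zero_right)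
    qed (simp add: egen_def)
  qed simp
  also have "\<dots> = ?c"
  proof (cases "finite K")
    case True
    then have "(\<Sum>I\<in>Pow K. if I = {i} then ?c else 0) = (if {i} \<in> Pow K then ?c else 0)"
      by (simp only: sum.delta finite_Pow_iff)
    also have "\<dots> = ?c" by simp
    finally show ?thesis .
  next
    case False
    then have "K \<noteq> {i, j}" by auto
    then show ?thesis using False by simp
  qed
  also have "esgn {i} {j} = (if j < i then - 1 else (1::'k))"
  proof -
    have "{(i', j'). i' \<in> {i} \<and> j' \<in> {j} \<and> j' < i'} = (if j < i then {(i, j)} else {})" by auto
    then show ?thesis by (simp add: esgn_def)
  qed
  finally show "(egen i \<otimes>\<^bsub>E_ring n\<^esub> egen j) K = (if i \<noteq> j \<and> K = {i, j} then (if i < j then 1 else - 1) else (0::'k))"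
    by auto
qed

lemma S_ring_cring: "cring (S_ring n :: 'k::field mpoly ring)"
proof (rule cringI)
  show "abelian_group (S_ring n :: 'k mpoly ring)"
  proof (rule abelian_groupI)
    fix f :: "'k mpoly" assume "f \<in> carrier (S_ring n)"
    then show "\<exists>y\<in>carrier (S_ring n). y \<oplus>\<^bsub>S_ring n\<^esub> f = \<zero>\<^bsub>S_ring n\<^esub>"
      by (intro bexI[of _ "- f"]) (auto simp: S_ring_def)
  next
    fix f g :: "'k mpoly" assume "f \<in> carrier (S_ring n)" "g \<in> carrier (S_ring n)"
    then show "f \<oplus>\<^bsub>S_ring n\<^esub> g \<in> carrier (S_ring n)"
      using Poly_Mapping.keys_add[of f g] by (auto simp: S_ring_def)
  qed (auto simp: S_ring_def algebra_simps)
  show "comm_monoid (S_ring n :: 'k mpoly ring)"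
  proof (rule comm_monoidI)
    fix f g :: "'k mpoly" assume fg: "f \<in> carrier (S_ring n)" "g \<in> carrier (S_ring n)"
    show "f \<otimes>\<^bsub>S_ring n\<^esub> g \<in> carrier (S_ring n)"
    proof -
      have "Poly_Mapping.keys m \<subseteq> {..n}" if m: "m \<in> Poly_Mapping.keys (f * g)" for m
      proof -
        obtain u v where "m = u + v" "u \<in> Poly_Mapping.keys f" "v \<in> Poly_Mapping.keys g"
          using m Poly_Mapping.keys_mult[of f g] by blast
        then show ?thesis using fg Poly_Mapping.keys_add[of u v] by (force simp: S_ring_def)
      qed
      then show ?thesis by (simp add: S_ring_def)
    qed
  qed (auto simp: S_ring_def mult_ac)
qed (auto simp: S_ring_def algebra_simps)


section \<open>Graded modules\<close>

text \<open>
  The ring multiplication and unit contained in the library's module record play no role for a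
  module; where a module is constructed they are left undefined.
\<close>

record ('r, 'm, 'd) graded = "('r, 'm) module" +
  grade :: "'d \<Rightarrow> 'm set"

definition sum_of_subgroups ::
    "('m, 'x) ring_scheme \<Rightarrow> 'i set \<Rightarrow> ('i \<Rightarrow> 'm set) \<Rightarrow> 'm set" where
  "sum_of_subgroups M I A =
     {finsum M c J | c J. finite J \<and> J \<subseteq> I \<and> (\<forall>j\<in>J. c j \<in> A j)}"

definition internal_direct_sum ::
    "('m, 'x) ring_scheme \<Rightarrow> ('i \<Rightarrow> 'm set) \<Rightarrow> bool" where
  "internal_direct_sum M A \<longleftrightarrow>
     (\<forall>i. subgroup (A i) (add_monoid M)) \<and>
     (\<forall>x\<in>carrier M. \<exists>!c. (\<forall>i. c i \<in> A i) \<and> finite {i. c i \<noteq> \<zero>\<^bsub>M\<^esub>} \<and>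
        x = finsum M c {i. c i \<noteq> \<zero>\<^bsub>M\<^esub>})"

definition graded_S_module ::
    "nat \<Rightarrow> (nat \<Rightarrow> nat) \<Rightarrow> ('k::field mpoly, 'm, int) graded \<Rightarrow> bool" where
  "graded_S_module n a M \<longleftrightarrow>
     Module.module (S_ring n) M \<and> internal_direct_sum M (grade M) \<and>
     (\<forall>c d. \<forall>p\<in>S_deg n a c. \<forall>x\<in>grade M d. p \<odot>\<^bsub>M\<^esub> x \<in> grade M (c + d))"

definition fin_gen :: "('r, 'x) ring_scheme \<Rightarrow> ('r, 'm, 'y) module_scheme \<Rightarrow> bool" where
  "fin_gen R M \<longleftrightarrow> (\<exists>A. finite A \<and> A \<subseteq> carrier M \<and>
     (\<forall>N. submodule N R M \<and> A \<subseteq> N \<longrightarrow> N = carrier M))"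

definition trunc :: "int \<Rightarrow> ('r, 'm, int, 'x) graded_scheme \<Rightarrow> ('r, 'm, int, 'x) graded_scheme" where
  "trunc r M = M\<lparr>carrier := sum_of_subgroups M {r..} (grade M),
     grade := (\<lambda>d. if r \<le> d then grade M d else {\<zero>\<^bsub>M\<^esub>})\<rparr>"

definition twist1 :: "int \<Rightarrow> ('r, 'm, int, 'x) graded_scheme \<Rightarrow> ('r, 'm, int, 'x) graded_scheme" where
  "twist1 j M = M\<lparr>grade := (\<lambda>d. grade M (j + d))\<rparr>"

definition twist2 :: "int \<times> int \<Rightarrow> ('r, 'm, int \<times> int, 'x) graded_scheme
    \<Rightarrow> ('r, 'm, int \<times> int, 'x) graded_scheme" where
  "twist2 = (\<lambda>(c, s) N. N\<lparr>grade := (\<lambda>(d, t). grade N (c + d, s + t))\<rparr>)"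

definition degree_part ::
    "('k::field mpoly, 'm, int, 'x) graded_scheme \<Rightarrow> int \<Rightarrow> ('k, 'm) module" where
  "degree_part M d = \<lparr>carrier = grade M d, mult = undefined, one = undefined,
     zero = \<zero>\<^bsub>M\<^esub>, add = add M, smult = (\<lambda>c x. scalar c \<odot>\<^bsub>M\<^esub> x)\<rparr>"

definition quot_module ::
    "('r, 'm, 'x) module_scheme \<Rightarrow> 'm set \<Rightarrow> ('r, 'm set) module" where
  "quot_module M H = \<lparr>carrier = a_rcosets\<^bsub>M\<^esub> H, mult = undefined, one = undefined,
     zero = H, add = set_add M, smult = (\<lambda>c X. H <+>\<^bsub>M\<^esub> ((\<odot>\<^bsub>M\<^esub>) c ` X))\<rparr>"


section \<open>Modules over the exterior algebra\<close>

text \<open>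
  Modules over the exterior algebra are right modules, \<open>e \<odot> x\<close> denoting \<open>x \<cdot> e\<close>.  This is the
  convention under which the differential \<open>m \<otimes> f \<mapsto> \<Sum> x_i m \<otimes> e_i f\<close> of the complex \<open>\<bold>R(M)\<close>
  is linear over the exterior algebra with no signs.
\<close>

locale right_module = R?: ring R + M?: abelian_group M
    for R (structure) and M :: "('r, 'm, 'x) module_scheme" (structure) +
  assumes smult_closed: "\<lbrakk>e \<in> carrier R; x \<in> carrier M\<rbrakk> \<Longrightarrow> e \<odot>\<^bsub>M\<^esub> x \<in> carrier M"
    and smult_l_distr: "\<lbrakk>e \<in> carrier R; f \<in> carrier R; x \<in> carrier M\<rbrakk> \<Longrightarrow>
      (e \<oplus> f) \<odot>\<^bsub>M\<^esub> x = e \<odot>\<^bsub>M\<^esub> x \<oplus>\<^bsub>M\<^esub> f \<odot>\<^bsub>M\<^esub> x"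
    and smult_r_distr: "\<lbrakk>e \<in> carrier R; x \<in> carrier M; y \<in> carrier M\<rbrakk> \<Longrightarrow>
      e \<odot>\<^bsub>M\<^esub> (x \<oplus>\<^bsub>M\<^esub> y) = e \<odot>\<^bsub>M\<^esub> x \<oplus>\<^bsub>M\<^esub> e \<odot>\<^bsub>M\<^esub> y"
    and smult_assoc: "\<lbrakk>e \<in> carrier R; f \<in> carrier R; x \<in> carrier M\<rbrakk> \<Longrightarrow>
      (e \<otimes> f) \<odot>\<^bsub>M\<^esub> x = f \<odot>\<^bsub>M\<^esub> (e \<odot>\<^bsub>M\<^esub> x)"
    and smult_one: "x \<in> carrier M \<Longrightarrow> \<one> \<odot>\<^bsub>M\<^esub> x = x"

type_synonym ('k, 'm) graded_E = "(nat set \<Rightarrow> 'k, 'm, int \<times> int) graded"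

definition graded_E_module ::
    "nat \<Rightarrow> (nat \<Rightarrow> nat) \<Rightarrow> (nat set \<Rightarrow> 'k::field, 'm, int \<times> int, 'x) graded_scheme \<Rightarrow> bool" where
  "graded_E_module n a D \<longleftrightarrow>
     right_module (E_ring n) D \<and> internal_direct_sum D (grade D) \<and>
     (\<forall>c s d t. \<forall>e\<in>E_deg n a (c, s). \<forall>x\<in>grade D (d, t). e \<odot>\<^bsub>D\<^esub> x \<in> grade D (c + d, s + t))"

definition graded_E_hom ::
    "nat \<Rightarrow> (nat set \<Rightarrow> 'k::field, 'm, int \<times> int, 'x) graded_scheme
      \<Rightarrow> (nat set \<Rightarrow> 'k, 'l, int \<times> int, 'y) graded_scheme
      \<Rightarrow> int \<times> int \<Rightarrow> ('m \<Rightarrow> 'l) \<Rightarrow> bool" where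
  "graded_E_hom n D D' = (\<lambda>(c, s) f. f \<in> carrier D \<rightarrow> carrier D' \<and>
     (\<forall>x\<in>carrier D. \<forall>y\<in>carrier D. f (x \<oplus>\<^bsub>D\<^esub> y) = f x \<oplus>\<^bsub>D'\<^esub> f y) \<and>
     (\<forall>e\<in>carrier (E_ring n). \<forall>x\<in>carrier D. f (e \<odot>\<^bsub>D\<^esub> x) = e \<odot>\<^bsub>D'\<^esub> f x) \<and>
     (\<forall>d t. f ` grade D (d, t) \<subseteq> grade D' (c + d, s + t)))"

definition graded_E_iso ::
    "nat \<Rightarrow> (nat \<Rightarrow> nat) \<Rightarrow> (nat set \<Rightarrow> 'k::field, 'm, int \<times> int, 'x) graded_scheme
      \<Rightarrow> (nat set \<Rightarrow> 'k, 'l, int \<times> int, 'y) graded_scheme \<Rightarrow> ('m \<Rightarrow> 'l) \<Rightarrow> bool" where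
  "graded_E_iso n a D D' f \<longleftrightarrow> graded_E_module n a D \<and> graded_E_module n a D' \<and>
     graded_E_hom n D D' (0, 0) f \<and> bij_betw f (carrier D) (carrier D')"

text \<open>
  For a vector space \<open>V\<close>, placed in degree \<open>(0;0)\<close>, the module \<open>V \<otimes> E\<close> consists of the families \<open>f\<close>
  in \<open>V\<close> standing for the sum of the \<open>f I \<otimes> e_I\<close>.  Since \<open>V \<otimes> E(c;s) = (V \<otimes> E)(c;s)\<close>, twisting
  it by \<open>(-a_0-...-a_n; -n-1)\<close> gives \<open>V \<otimes> \<omega>_E\<close>.
\<close>

definition tensor_E ::
    "nat \<Rightarrow> (nat \<Rightarrow> nat) \<Rightarrow> ('k::field, 'v, 'x) module_scheme \<Rightarrow> ('k, nat set \<Rightarrow> 'v) graded_E" where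
  "tensor_E n a V = \<lparr>
     carrier = {f. \<forall>I. if I \<subseteq> {..n} then f I \<in> carrier V else f I = \<zero>\<^bsub>V\<^esub>},
     mult = undefined, one = undefined,
     zero = (\<lambda>I. \<zero>\<^bsub>V\<^esub>),
     add = (\<lambda>f g I. if I \<subseteq> {..n} then f I \<oplus>\<^bsub>V\<^esub> g I else \<zero>\<^bsub>V\<^esub>),
     smult = (\<lambda>e f K. if K \<subseteq> {..n}
       then finsum V (\<lambda>I. (esgn I (K - I) * e (K - I)) \<odot>\<^bsub>V\<^esub> f I) (Pow K) else \<zero>\<^bsub>V\<^esub>),
     grade = (\<lambda>p. {f. \<forall>I. (if I \<subseteq> {..n} then f I \<in> carrier V else f I = \<zero>\<^bsub>V\<^esub>) \<and>
       (f I \<noteq> \<zero>\<^bsub>V\<^esub> \<longrightarrow> edeg a I = p)})\<rparr>"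

definition tensor_omega ::
    "nat \<Rightarrow> (nat \<Rightarrow> nat) \<Rightarrow> ('k::field, 'v, 'x) module_scheme \<Rightarrow> ('k, nat set \<Rightarrow> 'v) graded_E" where
  "tensor_omega n a V = twist2 (- (\<Sum>i\<le>n. int (a i)), - int n - 1) (tensor_E n a V)"

definition direct_sum ::
    "('i \<Rightarrow> ('r, 'm, 'd) graded) \<Rightarrow> ('r, 'i \<Rightarrow> 'm, 'd) graded" where
  "direct_sum N = \<lparr>
     carrier = {f. (\<forall>i. f i \<in> carrier (N i)) \<and> finite {i. f i \<noteq> \<zero>\<^bsub>N i\<^esub>}},
     mult = undefined, one = undefined,
     zero = (\<lambda>i. \<zero>\<^bsub>N i\<^esub>),
     add = (\<lambda>f g i. f i \<oplus>\<^bsub>N i\<^esub> g i),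
     smult = (\<lambda>e f i. e \<odot>\<^bsub>N i\<^esub> f i),
     grade = (\<lambda>d. {f. (\<forall>i. f i \<in> grade (N i) d) \<and> finite {i. f i \<noteq> \<zero>\<^bsub>N i\<^esub>}})\<rparr>"


section \<open>Differential modules\<close>

record ('k, 'm) diff_mod = "(nat set \<Rightarrow> 'k, 'm, int \<times> int) graded" +
  diff :: "'m \<Rightarrow> 'm"

definition differential_module ::
    "nat \<Rightarrow> (nat \<Rightarrow> nat) \<Rightarrow> ('k::field, 'm) diff_mod \<Rightarrow> bool" where
  "differential_module n a D \<longleftrightarrow> graded_E_module n a D \<and>
     graded_E_hom n D D (0, - 1) (diff D) \<and>
     (\<forall>x\<in>carrier D. diff D (diff D x) = \<zero>\<^bsub>D\<^esub>)"

definition diff_morphism ::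
    "nat \<Rightarrow> ('k::field, 'm) diff_mod \<Rightarrow> ('k, 'l) diff_mod \<Rightarrow> ('m \<Rightarrow> 'l) \<Rightarrow> bool" where
  "diff_morphism n D D' f \<longleftrightarrow> graded_E_hom n D D' (0, 0) f \<and>
     (\<forall>x\<in>carrier D. f (diff D x) = diff D' (f x))"

definition boundaries :: "('k, 'm) diff_mod \<Rightarrow> 'm set" where
  "boundaries D = diff D ` carrier D"

definition homology :: "('k, 'm) diff_mod \<Rightarrow> (nat set \<Rightarrow> 'k, 'm set) module" where
  "homology D = quot_module (D\<lparr>carrier := {x \<in> carrier D. diff D x = \<zero>\<^bsub>D\<^esub>}\<rparr>) (boundaries D)"

definition homology_map :: "('k, 'l) diff_mod \<Rightarrow> ('m \<Rightarrow> 'l) \<Rightarrow> 'm set \<Rightarrow> 'l set" where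
  "homology_map D' f X = boundaries D' <+>\<^bsub>D'\<^esub> (f ` X)"

definition quasi_isomorphism ::
    "nat \<Rightarrow> ('k::field, 'm) diff_mod \<Rightarrow> ('k, 'l) diff_mod \<Rightarrow> ('m \<Rightarrow> 'l) \<Rightarrow> bool" where
  "quasi_isomorphism n D D' f \<longleftrightarrow> diff_morphism n D D' f \<and>
     bij_betw (homology_map D' f) (carrier (homology D)) (carrier (homology D'))"

definition cone ::
    "('k::field, 'm) diff_mod \<Rightarrow> ('k, 'l) diff_mod \<Rightarrow> ('m \<Rightarrow> 'l) \<Rightarrow> ('k, 'l \<times> 'm) diff_mod" where
  "cone D D' f = \<lparr>
     carrier = carrier D' \<times> carrier D,
     mult = undefined, one = undefined,
     zero = (\<zero>\<^bsub>D'\<^esub>, \<zero>\<^bsub>D\<^esub>),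
     add = (\<lambda>(x, y) (x', y'). (x \<oplus>\<^bsub>D'\<^esub> x', y \<oplus>\<^bsub>D\<^esub> y')),
     smult = (\<lambda>e (x, y). (e \<odot>\<^bsub>D'\<^esub> x, e \<odot>\<^bsub>D\<^esub> y)),
     grade = (\<lambda>p. grade D' p \<times> grade (twist2 (0, - 1) D) p),
     diff = (\<lambda>(x, y). (diff D' x \<oplus>\<^bsub>D'\<^esub> f y, \<ominus>\<^bsub>D\<^esub> diff D y))\<rparr>"

text \<open>
  \<open>D \<otimes>\<^sub>E \<bold>k\<close> is the quotient of \<open>D\<close> by \<open>D \<cdot> (e_0, ..., e_n)\<close>.
\<close>

definition rad :: "nat \<Rightarrow> ('k::field, 'm) diff_mod \<Rightarrow> 'm set" where
  "rad n D = sum_of_subgroups D {..n} (\<lambda>i. {egen i \<odot>\<^bsub>D\<^esub> x | x. x \<in> carrier D})"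

definition tensor_k :: "nat \<Rightarrow> ('k::field, 'm) diff_mod \<Rightarrow> (nat set \<Rightarrow> 'k, 'm set) module" where
  "tensor_k n D = quot_module D (rad n D)"

definition minimal :: "nat \<Rightarrow> ('k::field, 'm) diff_mod \<Rightarrow> bool" where
  "minimal n D \<longleftrightarrow> (\<forall>X\<in>carrier (tensor_k n D). rad n D <+>\<^bsub>D\<^esub> (diff D ` X) = \<zero>\<^bsub>tensor_k n D\<^esub>)"

definition graded_free :: "nat \<Rightarrow> ('k::field, 'm) diff_mod \<Rightarrow> 'm set \<Rightarrow> bool" where
  "graded_free n D U \<longleftrightarrow> submodule U (E_ring n) D \<and>
     (\<exists>B\<subseteq>U. (\<forall>b\<in>B. \<exists>p. b \<in> grade D p) \<and>
       (\<forall>x\<in>U. \<exists>!g. (\<forall>b. g b \<in> carrier (E_ring n)) \<and>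
          finite {b. g b \<noteq> \<zero>\<^bsub>E_ring n\<^esub>} \<and> {b. g b \<noteq> \<zero>\<^bsub>E_ring n\<^esub>} \<subseteq> B \<and>
          x = finsum D (\<lambda>b. g b \<odot>\<^bsub>D\<^esub> b) {b. g b \<noteq> \<zero>\<^bsub>E_ring n\<^esub>}))"

definition free_flag :: "nat \<Rightarrow> (nat \<Rightarrow> nat) \<Rightarrow> ('k::field, 'm) diff_mod \<Rightarrow> bool" where
  "free_flag n a F \<longleftrightarrow> differential_module n a F \<and>
     (\<exists>Fl :: int \<Rightarrow> 'm set. internal_direct_sum F Fl \<and>
        (\<forall>i. graded_free n F (Fl i)) \<and>
        (\<exists>i0. \<forall>i<i0. Fl i = {\<zero>\<^bsub>F\<^esub>}) \<and>
        (\<forall>i. diff F ` Fl i \<subseteq> sum_of_subgroups F {..<i} Fl))"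

definition minimal_free_flag_resolution ::
    "nat \<Rightarrow> (nat \<Rightarrow> nat) \<Rightarrow> ('k::field, 'm) diff_mod \<Rightarrow> ('k, 'l) diff_mod \<Rightarrow> ('m \<Rightarrow> 'l) \<Rightarrow> bool" where
  "minimal_free_flag_resolution n a F D f \<longleftrightarrow>
     differential_module n a D \<and> free_flag n a F \<and> minimal n F \<and> quasi_isomorphism n F D f"


section \<open>The functor \<open>\<bold>R\<close>\<close>

text \<open>
  The component in \<open>M_d \<otimes> \<omega>_E(-d;0)\<close> of \<open>\<Sum>\<^sub>i x_i m \<otimes> e_i e_I\<close> with \<open>m \<in> M_(d - a_i)\<close>:
  the coefficient of \<open>e_K\<close> comes from those \<open>i \<in> K\<close> with \<open>I = K - {i}\<close>.
\<close>

definition R_diff ::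
    "nat \<Rightarrow> (nat \<Rightarrow> nat) \<Rightarrow> ('k::field mpoly, 'm, int) graded
      \<Rightarrow> (int \<Rightarrow> nat set \<Rightarrow> 'm) \<Rightarrow> (int \<Rightarrow> nat set \<Rightarrow> 'm)" where
  "R_diff n a M f = (\<lambda>d K. if K \<subseteq> {..n}
     then finsum M (\<lambda>i. scalar (esgn {i} (K - {i})) \<odot>\<^bsub>M\<^esub> (var i \<odot>\<^bsub>M\<^esub> f (d - int (a i)) (K - {i}))) K
     else \<zero>\<^bsub>M\<^esub>)"

definition R_functor ::
    "nat \<Rightarrow> (nat \<Rightarrow> nat) \<Rightarrow> ('k::field mpoly, 'm, int) graded
      \<Rightarrow> ('k, int \<Rightarrow> nat set \<Rightarrow> 'm) diff_mod" where
  "R_functor n a M =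
     graded.extend (direct_sum (\<lambda>d. twist2 (- d, 0) (tensor_omega n a (degree_part M d))))
       (diff_mod.fields (R_diff n a M))"


section \<open>Localization and cohomology\<close>

definition loc_rel ::
    "('r, 'x) ring_scheme \<Rightarrow> ('r, 'm, 'y) module_scheme \<Rightarrow> 'r \<Rightarrow> (('m \<times> nat) \<times> ('m \<times> nat)) set" where
  "loc_rel R M f = {((x, k), (y, l)). x \<in> carrier M \<and> y \<in> carrier M \<and>
     (\<exists>p. (f [^]\<^bsub>R\<^esub> (p + l)) \<odot>\<^bsub>M\<^esub> x = (f [^]\<^bsub>R\<^esub> (p + k)) \<odot>\<^bsub>M\<^esub> y)}"

text \<open>The fraction \<open>x / f^k\<close>.\<close>

definition frac ::
    "('r, 'x) ring_scheme \<Rightarrow> ('r, 'm, 'y) module_scheme \<Rightarrow> 'r \<Rightarrow> 'm \<Rightarrow> nat \<Rightarrow> ('m \<times> nat) set" where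
  "frac R M f x k = loc_rel R M f `` {(x, k)}"

text \<open>The localization of \<open>M\<close> at the powers of \<open>f\<close>, where \<open>f\<close> is homogeneous of degree \<open>w\<close>.\<close>

definition localization ::
    "('r, 'x) ring_scheme \<Rightarrow> ('r, 'm, int) graded \<Rightarrow> 'r \<Rightarrow> int \<Rightarrow> ('r, ('m \<times> nat) set, int) graded" where
  "localization R M f w = \<lparr>
     carrier = (carrier M \<times> UNIV) // loc_rel R M f,
     mult = undefined, one = undefined,
     zero = frac R M f \<zero>\<^bsub>M\<^esub> 0,
     add = (\<lambda>X Y. \<Union>(x, k)\<in>X. \<Union>(y, l)\<in>Y.
       frac R M f ((f [^]\<^bsub>R\<^esub> l) \<odot>\<^bsub>M\<^esub> x \<oplus>\<^bsub>M\<^esub> (f [^]\<^bsub>R\<^esub> k) \<odot>\<^bsub>M\<^esub> y) (k + l)),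
     smult = (\<lambda>s X. \<Union>(x, k)\<in>X. frac R M f (s \<odot>\<^bsub>M\<^esub> x) k),
     grade = (\<lambda>d. {frac R M f x k | x k. x \<in> grade M (d + int k * w)})\<rparr>"

definition xmon :: "nat set \<Rightarrow> 'k::field mpoly" where
  "xmon I = (\<Prod>i\<in>I. var i)"

definition loc_at ::
    "nat \<Rightarrow> (nat \<Rightarrow> nat) \<Rightarrow> ('k::field mpoly, 'm, int) graded \<Rightarrow> nat set
      \<Rightarrow> ('k mpoly, ('m \<times> nat) set, int) graded" where
  "loc_at n a M I = localization (S_ring n) M (xmon I) (\<Sum>i\<in>I. int (a i))"

text \<open>
  The localization map to the localization at \<open>x_K\<close> from that at \<open>x_(K - {i})\<close>, for \<open>i \<in> K\<close>:
  \<open>x / x_(K - {i})^k = x_i^k x / x_K^k\<close>.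
\<close>

definition loc_map ::
    "nat \<Rightarrow> ('k::field mpoly, 'm, int) graded \<Rightarrow> nat set \<Rightarrow> nat \<Rightarrow> ('m \<times> nat) set \<Rightarrow> ('m \<times> nat) set" where
  "loc_map n M K i X = (\<Union>(x, k)\<in>X. frac (S_ring n) M (xmon K) ((var i ^ k) \<odot>\<^bsub>M\<^esub> x) k)"

text \<open>
  The degree \<open>j\<close> strand of the Cech complex on \<open>x_0, ..., x_n\<close> whose \<open>p\<close>-th term is the product
  of the localizations of \<open>M\<close> at \<open>x_I\<close>, over the \<open>I\<close> in \<open>\<I>\<close> with \<open>p\<close> elements.  With \<open>\<I>\<close> all
  subsets of \<open>{0..n}\<close> it computes local cohomology with support in \<open>\<mm>\<close>; with \<open>\<I>\<close> the nonempty
  subsets it is, up to a shift by one of the cohomological degree, the Cech complex of the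
  sheaf associated with \<open>M\<close> (of its \<open>j\<close>-th twist) for the covering of \<open>\<P>(\<a>)\<close> by the open
  substacks \<open>x_i \<noteq> 0\<close>.
\<close>

definition cech_cochains ::
    "nat \<Rightarrow> (nat \<Rightarrow> nat) \<Rightarrow> ('k::field mpoly, 'm, int) graded \<Rightarrow> nat set set \<Rightarrow> nat \<Rightarrow> int
      \<Rightarrow> ('k, nat set \<Rightarrow> ('m \<times> nat) set) module" where
  "cech_cochains n a M \<I> p j = (let J = {I \<in> \<I>. card I = p} in \<lparr>
     carrier = (\<Pi>\<^sub>E I\<in>J. grade (loc_at n a M I) j),
     mult = undefined, one = undefined,
     zero = (\<lambda>I\<in>J. \<zero>\<^bsub>loc_at n a M I\<^esub>),
     add = (\<lambda>c c'. \<lambda>I\<in>J. c I \<oplus>\<^bsub>loc_at n a M I\<^esub> c' I),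
     smult = (\<lambda>s c. \<lambda>I\<in>J. scalar s \<odot>\<^bsub>loc_at n a M I\<^esub> c I)\<rparr>)"

definition cech_diff ::
    "nat \<Rightarrow> (nat \<Rightarrow> nat) \<Rightarrow> ('k::field mpoly, 'm, int) graded \<Rightarrow> nat set set \<Rightarrow> nat
      \<Rightarrow> (nat set \<Rightarrow> ('m \<times> nat) set) \<Rightarrow> (nat set \<Rightarrow> ('m \<times> nat) set)" where
  "cech_diff n a M \<I> p c = (\<lambda>K\<in>{K \<in> \<I>. card K = Suc p}.
     finsum (loc_at n a M K)
       (\<lambda>i. scalar ((- 1) ^ card {l \<in> K. l < i}) \<odot>\<^bsub>loc_at n a M K\<^esub> loc_map n M K i (c (K - {i})))
       {i \<in> K. K - {i} \<in> \<I>})"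

definition cech_boundaries ::
    "nat \<Rightarrow> (nat \<Rightarrow> nat) \<Rightarrow> ('k::field mpoly, 'm, int) graded \<Rightarrow> nat set set \<Rightarrow> nat \<Rightarrow> int
      \<Rightarrow> (nat set \<Rightarrow> ('m \<times> nat) set) set" where
  "cech_boundaries n a M \<I> p j = (case p of
     0 \<Rightarrow> {\<zero>\<^bsub>cech_cochains n a M \<I> 0 j\<^esub>}
   | Suc q \<Rightarrow> cech_diff n a M \<I> q ` carrier (cech_cochains n a M \<I> q j))"

definition cech_cohomology ::
    "nat \<Rightarrow> (nat \<Rightarrow> nat) \<Rightarrow> ('k::field mpoly, 'm, int) graded \<Rightarrow> nat set set \<Rightarrow> nat \<Rightarrow> int
      \<Rightarrow> ('k, (nat set \<Rightarrow> ('m \<times> nat) set) set) module" where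
  "cech_cohomology n a M \<I> p j = quot_module
     ((cech_cochains n a M \<I> p j)\<lparr>carrier :=
        {c \<in> carrier (cech_cochains n a M \<I> p j).
          cech_diff n a M \<I> p c = \<zero>\<^bsub>cech_cochains n a M \<I> (Suc p) j\<^esub>}\<rparr>)
     (cech_boundaries n a M \<I> p j)"

text \<open>The degree \<open>j\<close> part of the \<open>i\<close>-th local cohomology of \<open>M\<close>.\<close>

definition local_cohomology ::
    "nat \<Rightarrow> (nat \<Rightarrow> nat) \<Rightarrow> ('k::field mpoly, 'm, int) graded \<Rightarrow> nat \<Rightarrow> int
      \<Rightarrow> ('k, (nat set \<Rightarrow> ('m \<times> nat) set) set) module" where
  "local_cohomology n a M i j = cech_cohomology n a M (Pow {..n}) i j"

text \<open>
  The \<open>i\<close>-th cohomology of the sheaf associated with \<open>M\<close>.  On the open substack where the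
  \<open>x_i\<close>, \<open>i \<in> I\<close>, do not vanish, the sections of this sheaf are the elements of degree \<open>0\<close> of the
  localization at \<open>x_I\<close>.  Its twist by \<open>\<O>(j)\<close> is the sheaf associated with \<open>M(j)\<close>.
\<close>

definition sheaf_cohomology ::
    "nat \<Rightarrow> (nat \<Rightarrow> nat) \<Rightarrow> ('k::field mpoly, 'm, int) graded \<Rightarrow> nat
      \<Rightarrow> ('k, (nat set \<Rightarrow> ('m \<times> nat) set) set) module" where
  "sheaf_cohomology n a M i = cech_cohomology n a M (Pow {..n} - {{}}) (Suc i) 0"


section \<open>Regularity and Tate resolutions\<close>

definition regular :: "nat \<Rightarrow> (nat \<Rightarrow> nat) \<Rightarrow> ('k::field mpoly, 'm, int) graded \<Rightarrow> int \<Rightarrow> bool" where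
  "regular n a M r \<longleftrightarrow> (\<forall>i j. j > r - int i \<longrightarrow>
     carrier (local_cohomology n a M i j) = {\<zero>\<^bsub>local_cohomology n a M i j\<^esub>})"

definition reg :: "nat \<Rightarrow> (nat \<Rightarrow> nat) \<Rightarrow> ('k::field mpoly, 'm, int) graded \<Rightarrow> ereal" where
  "reg n a M = (INF r\<in>{r. regular n a M r}. ereal (of_int r))"

text \<open>\<open>T\<close> is a Tate resolution of the sheaf associated with the finitely generated module \<open>M\<close>.\<close>

definition is_tate_resolution ::
    "nat \<Rightarrow> (nat \<Rightarrow> nat) \<Rightarrow> ('k::field mpoly, 'm, int) graded
      \<Rightarrow> ('k, (int \<Rightarrow> nat set \<Rightarrow> 'm) \<times> 'f) diff_mod \<Rightarrow> bool" where
  "is_tate_resolution n a M T \<longleftrightarrow> (\<exists>r F \<epsilon>. reg n a M < ereal (of_int r) \<and>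
     minimal_free_flag_resolution n a F (R_functor n a (trunc r M)) \<epsilon> \<and>
     T = cone F (R_functor n a (trunc r M)) \<epsilon>)"

text \<open>The direct sum over \<open>i\<close> and \<open>j\<close> of the modules \<open>H\<^sup>i(\<P>(\<a>), \<F>(j)) \<otimes> \<omega>_E(-j;i)\<close>.\<close>

definition cohomology_E_module ::
    "nat \<Rightarrow> (nat \<Rightarrow> nat) \<Rightarrow> ('k::field mpoly, 'm, int) graded
      \<Rightarrow> ('k, nat \<times> int \<Rightarrow> nat set \<Rightarrow> (nat set \<Rightarrow> ('m \<times> nat) set) set) graded_E" where
  "cohomology_E_module n a M = direct_sum (\<lambda>(i, j).
     twist2 (- j, int i) (tensor_omega n a (sheaf_cohomology n a (twist1 j M) i)))"

text \<open>
  The part of \<open>T\<close> corresponding, under an identification \<open>\<phi>\<close> of \<open>T\<close> with that direct sum, to the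
  summands with \<open>- i - j = l\<close>.
\<close>

definition tate_strand ::
    "nat \<Rightarrow> (nat \<Rightarrow> nat) \<Rightarrow> ('k::field mpoly, 'm, int) graded
      \<Rightarrow> ('k, 't) diff_mod
      \<Rightarrow> ('t \<Rightarrow> nat \<times> int \<Rightarrow> nat set \<Rightarrow> (nat set \<Rightarrow> ('m \<times> nat) set) set) \<Rightarrow> int \<Rightarrow> 't set" where
  "tate_strand n a M T \<phi> l = {t \<in> carrier T. \<forall>i j. - int i - j \<noteq> l \<longrightarrow>
     \<phi> t (i, j) = \<zero>\<^bsub>cohomology_E_module n a M\<^esub> (i, j)}"

end

theory Submission
  imports Defs
begin

text \<open>
  The summand \<open>H\<^sup>i(\<F>(j)) \<otimes> \<omega>_E(-j;i)\<close> is generated over \<open>E\<close> in the single degree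
  \<open>(a + j; n + 1 - i)\<close>, where \<open>a\<close> is the sum of the \<open>a_i\<close>.  The differential has degree \<open>(0;-1)\<close>,
  so the component of the image of such a generator at \<open>e_I\<close> in the summand \<open>(i', j')\<close> can be
  nonzero only if \<open>j' - j = \<Sum>(k \<in> I) a_k\<close> and \<open>i' - i = 1 - |I|\<close>, and then
  \<open>- i' - j' = - i - j - 1 - \<Sum>(k \<in> I) (a_k - 1)\<close>.  As all \<open>a_k\<close> are positive, the last sum
  lies between \<open>0\<close> and \<open>\<sigma>\<close>.  Linearity over \<open>E\<close> extends this from generators to all elements.
\<close>

section \<open>Localization\<close>

lemma (in Module.module) smult_pow_pow:
  fixes k l :: nat
  assumes "f \<in> carrier R" "x \<in> carrier M"
  shows "f [^] k \<odot>\<^bsub>M\<^esub> (f [^] l \<odot>\<^bsub>M\<^esub> x) = f [^] (k + l) \<odot>\<^bsub>M\<^esub> x"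
  using assms by (simp add: smult_assoc1[symmetric] nat_pow_mult)

text \<open>Powers of \<open>f\<close> may kill elements of \<open>M\<close>, and the free exponent
  \<open>p\<close> in the relation keeps it transitive nevertheless: witnesses \<open>p\<close> and
  \<open>q\<close> with middle denominator exponent \<open>l\<close> combine to the witness
  \<open>p + q + l\<close>.\<close>

lemma (in Module.module) loc_rel_equiv:
  assumes f: "f \<in> carrier R"
  shows "equiv (carrier M \<times> UNIV) (loc_rel R M f)"
proof (rule equivI)
  show "loc_rel R M f \<subseteq> (carrier M \<times> UNIV) \<times> (carrier M \<times> UNIV)"
    by (auto simp: loc_rel_def)
  show "refl_on (carrier M \<times> UNIV) (loc_rel R M f)"
    by (auto simp: refl_on_def loc_rel_def)
  show "sym (loc_rel R M f)"
    by (auto simp: sym_def loc_rel_def) metis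
  show "trans (loc_rel R M f)"
  proof (rule transI)
    fix X Y Z assume XY: "(X, Y) \<in> loc_rel R M f" and YZ: "(Y, Z) \<in> loc_rel R M f"
    obtain x k y l z m where X: "X = (x, k)" and Y: "Y = (y, l)" and Z: "Z = (z, m)"
      by (cases X; cases Y; cases Z)
    obtain p q where c: "x \<in> carrier M" "y \<in> carrier M" "z \<in> carrier M"
      and p: "f [^] (p + l) \<odot>\<^bsub>M\<^esub> x = f [^] (p + k) \<odot>\<^bsub>M\<^esub> y"
      and q: "f [^] (q + m) \<odot>\<^bsub>M\<^esub> y = f [^] (q + l) \<odot>\<^bsub>M\<^esub> z"
      using XY YZ by (auto simp: X Y Z loc_rel_def)
    have "f [^] (p + q + l + m) \<odot>\<^bsub>M\<^esub> x = f [^] (q + m) \<odot>\<^bsub>M\<^esub> (f [^] (p + l) \<odot>\<^bsub>M\<^esub> x)"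
      using f c by (simp add: smult_pow_pow add_ac)
    also have "\<dots> = f [^] (p + k) \<odot>\<^bsub>M\<^esub> (f [^] (q + m) \<odot>\<^bsub>M\<^esub> y)"
      using f c unfolding p by (simp add: smult_pow_pow add_ac)
    also have "\<dots> = f [^] (p + q + l + k) \<odot>\<^bsub>M\<^esub> z"
      using f c unfolding q by (simp add: smult_pow_pow add_ac)
    finally show "(X, Z) \<in> loc_rel R M f"
      using c by (auto simp: X Z loc_rel_def)
  qed
qed

lemma (in Module.module) smult_zero_left:
  assumes "x \<in> carrier M" shows "\<zero> \<odot>\<^bsub>M\<^esub> x = \<zero>\<^bsub>M\<^esub>"
  using smult_l_distr[of \<zero> \<zero> x] assms M.add.l_cancel_one[of "\<zero> \<odot>\<^bsub>M\<^esub> x"] by simp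

lemma (in Module.module) smult_zero_right:
  assumes "e \<in> carrier R" shows "e \<odot>\<^bsub>M\<^esub> \<zero>\<^bsub>M\<^esub> = \<zero>\<^bsub>M\<^esub>"
  using smult_r_distr[of e "\<zero>\<^bsub>M\<^esub>" "\<zero>\<^bsub>M\<^esub>"] assms by simp

lemma (in Module.module) frac_eqI:
  assumes "f \<in> carrier R" "x \<in> carrier M" "y \<in> carrier M"
    and "f [^] (p + l) \<odot>\<^bsub>M\<^esub> x = f [^] (p + k) \<odot>\<^bsub>M\<^esub> y"
  shows "frac R M f x k = frac R M f y l"
  using equiv_class_eq[OF loc_rel_equiv[OF assms(1)], of "(x, k)" "(y, l)"] assms
  by (auto simp: frac_def loc_rel_def)

lemma localization_cases:
  assumes "X \<in> carrier (localization R M f w)"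
  obtains x k where "x \<in> carrier M" "X = frac R M f x k"
  using assms by (auto simp: localization_def frac_def elim!: quotientE)

text \<open>The weight \<open>w\<close> enters a localization only through its grading, so
  \<open>L\<close> leaves it open and the algebra of fractions is developed for all \<open>w\<close>
  at once.\<close>

locale graded_localization = Module.module R M for R (structure) and M :: "('r, 'm, int) graded" (structure) +
  fixes f :: 'r
  assumes f: "f \<in> carrier R"
begin

abbreviation L where "L \<equiv> localization R M f"

section \<open>Arithmetic of fractions\<close>

lemma frac_in_localization:
  "x \<in> carrier M \<Longrightarrow> frac R M f x k \<in> carrier (L w)"
  by (auto simp: localization_def frac_def intro: quotientI)

text \<open>The operation is defined as a union over all representatives. It collapses to a single
  fraction because scalars commute with powers of \<open>f\<close> and hence respect
  \<open>loc_rel\<close>.\<close>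

lemma localization_smult_frac:
  assumes s: "s \<in> carrier R" and x: "x \<in> carrier M"
  shows "s \<odot>\<^bsub>L w\<^esub> frac R M f x k = frac R M f (s \<odot>\<^bsub>M\<^esub> x) k"
proof -
  have comm: "f [^] m \<odot>\<^bsub>M\<^esub> (s \<odot>\<^bsub>M\<^esub> y) = s \<odot>\<^bsub>M\<^esub> (f [^] m \<odot>\<^bsub>M\<^esub> y)" if "y \<in> carrier M" for m :: nat and y
    using f s that by (simp add: smult_assoc1[symmetric] m_comm)
  have "(\<lambda>(x, k). frac R M f (s \<odot>\<^bsub>M\<^esub> x) k) respects loc_rel R M f"
  proof (rule congruentI)
    fix Y Z assume "(Y, Z) \<in> loc_rel R M f"
    then obtain y k z l p where "Y = (y, k)" "Z = (z, l)" "y \<in> carrier M" "z \<in> carrier M"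
      "f [^] (p + l) \<odot>\<^bsub>M\<^esub> y = f [^] (p + k) \<odot>\<^bsub>M\<^esub> z"
      by (auto simp: loc_rel_def)
    then show "(case Y of (x, k) \<Rightarrow> frac R M f (s \<odot>\<^bsub>M\<^esub> x) k) = (case Z of (x, k) \<Rightarrow> frac R M f (s \<odot>\<^bsub>M\<^esub> x) k)"
      using f s by (simp, intro frac_eqI[of _ _ _ p]) (simp_all add: comm)
  qed
  from UN_equiv_class[OF loc_rel_equiv[OF f] this, of "(x, k)"] x
  show ?thesis by (simp add: localization_def frac_def)
qed

lemma localization_add_frac:
  assumes x: "x \<in> carrier M" and y: "y \<in> carrier M"
  shows "frac R M f x k \<oplus>\<^bsub>L w\<^esub> frac R M f y l =
    frac R M f (f [^] l \<odot>\<^bsub>M\<^esub> x \<oplus>\<^bsub>M\<^esub> f [^] k \<odot>\<^bsub>M\<^esub> y) (k + l)"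
proof -
  let ?g = "\<lambda>(x, k) (y, l). frac R M f (f [^] l \<odot>\<^bsub>M\<^esub> x \<oplus>\<^bsub>M\<^esub> f [^] k \<odot>\<^bsub>M\<^esub> y) (k + l)"
  have "congruent2 (loc_rel R M f) (loc_rel R M f) ?g"
  proof (rule congruent2I')
    fix X X' Y Y' assume X: "(X, X') \<in> loc_rel R M f" and Y: "(Y, Y') \<in> loc_rel R M f"
    obtain x k x' k' p where X': "X = (x, k)" "X' = (x', k')" "x \<in> carrier M" "x' \<in> carrier M"
      and p: "f [^] (p + k') \<odot>\<^bsub>M\<^esub> x = f [^] (p + k) \<odot>\<^bsub>M\<^esub> x'"
      using X by (auto simp: loc_rel_def)
    obtain y l y' l' q where Y': "Y = (y, l)" "Y' = (y', l')" "y \<in> carrier M" "y' \<in> carrier M"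
      and q: "f [^] (q + l') \<odot>\<^bsub>M\<^esub> y = f [^] (q + l) \<odot>\<^bsub>M\<^esub> y'"
      using Y by (auto simp: loc_rel_def)
    \<comment> \<open>The sum \<open>p + q\<close> of the two witnesses serves both numerators at
      once; the surplus powers of \<open>f\<close> are moved past the relation for \<open>x\<close>
      here and past the one for \<open>y\<close> below.\<close>
    have 1: "f [^] (p + q + (k' + l')) \<odot>\<^bsub>M\<^esub> (f [^] l \<odot>\<^bsub>M\<^esub> x) = f [^] (p + q + (k + l)) \<odot>\<^bsub>M\<^esub> (f [^] l' \<odot>\<^bsub>M\<^esub> x')"
    proof -
      have "f [^] (p + q + (k' + l')) \<odot>\<^bsub>M\<^esub> (f [^] l \<odot>\<^bsub>M\<^esub> x) = f [^] (q + l' + l) \<odot>\<^bsub>M\<^esub> (f [^] (p + k') \<odot>\<^bsub>M\<^esub> x)"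
        using f X' by (simp add: smult_pow_pow add_ac)
      also have "\<dots> = f [^] (p + q + (k + l)) \<odot>\<^bsub>M\<^esub> (f [^] l' \<odot>\<^bsub>M\<^esub> x')"
        using f X' unfolding p by (simp add: smult_pow_pow add_ac)
      finally show ?thesis .
    qed
    have 2: "f [^] (p + q + (k' + l')) \<odot>\<^bsub>M\<^esub> (f [^] k \<odot>\<^bsub>M\<^esub> y) = f [^] (p + q + (k + l)) \<odot>\<^bsub>M\<^esub> (f [^] k' \<odot>\<^bsub>M\<^esub> y')"
    proof -
      have "f [^] (p + q + (k' + l')) \<odot>\<^bsub>M\<^esub> (f [^] k \<odot>\<^bsub>M\<^esub> y) = f [^] (p + k' + k) \<odot>\<^bsub>M\<^esub> (f [^] (q + l') \<odot>\<^bsub>M\<^esub> y)"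
        using f Y' by (simp add: smult_pow_pow add_ac)
      also have "\<dots> = f [^] (p + q + (k + l)) \<odot>\<^bsub>M\<^esub> (f [^] k' \<odot>\<^bsub>M\<^esub> y')"
        using f Y' unfolding q by (simp add: smult_pow_pow add_ac)
      finally show ?thesis .
    qed
    show "?g X Y = ?g X' Y'"
      using f X' Y' by (simp, intro frac_eqI[of _ _ _ "p + q"]) (simp_all add: smult_r_distr 1 2)
  qed
  from UN_equiv_class2[OF loc_rel_equiv[OF f] loc_rel_equiv[OF f] this, of "(x, k)" "(y, l)"] x y
  show ?thesis by (simp add: localization_def frac_def case_prod_unfold)
qed

text \<open>This is the structure in which the finite sums of the Cech differential stay inside the
  localization.\<close>

lemma localization_abelian_monoid:
  shows "abelian_monoid (L w)"
proof (rule abelian_monoidI)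
  have zero: "\<zero>\<^bsub>L w\<^esub> = frac R M f \<zero>\<^bsub>M\<^esub> 0" by (simp add: localization_def)
  note frac = localization_add_frac
  show "\<zero>\<^bsub>L w\<^esub> \<in> carrier (L w)" by (simp add: zero frac_in_localization)
  fix X Y Z assume "X \<in> carrier (L w)"
  then obtain x k where x: "x \<in> carrier M" "X = frac R M f x k" by (rule localization_cases)
  show "\<zero>\<^bsub>L w\<^esub> \<oplus>\<^bsub>L w\<^esub> X = X" using f x by (simp add: zero frac)
  assume "Y \<in> carrier (L w)"
  then obtain y l where y: "y \<in> carrier M" "Y = frac R M f y l" by (rule localization_cases)
  show "X \<oplus>\<^bsub>L w\<^esub> Y \<in> carrier (L w)" using f x y by (simp add: frac frac_in_localization)
  show "X \<oplus>\<^bsub>L w\<^esub> Y = Y \<oplus>\<^bsub>L w\<^esub> X" using f x y by (simp add: frac add_ac M.a_comm)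
  assume "Z \<in> carrier (L w)"
  then obtain z m where z: "z \<in> carrier M" "Z = frac R M f z m" by (rule localization_cases)
  show "X \<oplus>\<^bsub>L w\<^esub> Y \<oplus>\<^bsub>L w\<^esub> Z = X \<oplus>\<^bsub>L w\<^esub> (Y \<oplus>\<^bsub>L w\<^esub> Z)"
    using f x y z by (simp add: frac smult_r_distr smult_pow_pow add_ac M.a_assoc)
qed

lemma localization_smult_closed:
  assumes "s \<in> carrier R" "X \<in> carrier (L w)"
  shows "s \<odot>\<^bsub>L w\<^esub> X \<in> carrier (L w)"
  using assms f by (auto elim!: localization_cases simp: localization_smult_frac frac_in_localization)

lemma localization_one_smult:
  assumes "X \<in> carrier (L w)"
  shows "\<one> \<odot>\<^bsub>L w\<^esub> X = X"
  using assms f by (auto elim!: localization_cases simp: localization_smult_frac)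

lemma localization_zero_smult:
  assumes "X \<in> carrier (L w)"
  shows "\<zero> \<odot>\<^bsub>L w\<^esub> X = \<zero>\<^bsub>L w\<^esub>"
proof -
  obtain x k where x: "x \<in> carrier M" and X: "X = frac R M f x k"
    using assms by (rule localization_cases)
  have "\<zero> \<odot>\<^bsub>L w\<^esub> X = frac R M f \<zero>\<^bsub>M\<^esub> k"
    using f x X by (simp add: localization_smult_frac smult_zero_left)
  \<comment> \<open>The denominator \<open>f^k\<close> survives multiplication by zero, whereas the
    zero of the localization is the fraction with exponent \<open>0\<close>.\<close>
  also have "\<dots> = frac R M f \<zero>\<^bsub>M\<^esub> 0"
    using f by (intro frac_eqI[of _ _ _ 0]) (simp_all add: smult_zero_right)
  finally show ?thesis by (simp add: localization_def)
qed

end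

section \<open>Cech cohomology\<close>

lemma S_ring_simps:
  "x \<otimes>\<^bsub>S_ring n\<^esub> y = x * y" "x \<oplus>\<^bsub>S_ring n\<^esub> y = x + y" "\<one>\<^bsub>S_ring n\<^esub> = 1" "\<zero>\<^bsub>S_ring n\<^esub> = 0"
  by (simp_all add: S_ring_def)

lemma S_ring_nat_pow: "p [^]\<^bsub>S_ring n\<^esub> (k::nat) = p ^ k"
  by (induction k) (simp_all add: nat_pow_def S_ring_simps mult.commute)

lemma scalar_in_S_ring: "scalar c \<in> carrier (S_ring n)"
  by (simp add: scalar_def S_ring_def)

lemma var_in_S_ring: "i \<le> n \<Longrightarrow> var i \<in> carrier (S_ring n)"
  by (simp add: var_def S_ring_def)

lemma xmon_in_S_ring:
  assumes "I \<subseteq> {..n}"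
  shows "(xmon I :: 'k::field mpoly) \<in> carrier (S_ring n)"
proof -
  interpret cring "S_ring n :: 'k mpoly ring" by (rule S_ring_cring)
  have "finite I" using assms finite_subset by blast
  then show ?thesis using assms
    by (induction I) (use m_closed one_closed var_in_S_ring in \<open>auto simp: xmon_def S_ring_simps\<close>)
qed

lemma loc_at_localization:
  assumes "Module.module (S_ring n) M" "I \<subseteq> {..n}"
  shows "graded_localization (S_ring n) M (xmon I)"
  using assms xmon_in_S_ring
  by (auto simp: graded_localization_def graded_localization_axioms_def)

text \<open>Since \<open>x_K = x_i x_(K - {i})\<close>, enlarging the denominator is compensated by
  a power of \<open>x_i\<close> in the numerator, and the result does not depend on the
  representative.\<close>

lemma loc_map_closed:
  fixes M :: "('k::field mpoly, 'm, int) graded"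
  assumes mod: "Module.module (S_ring n) M" and K: "K \<subseteq> {..n}" "i \<in> K"
    and X: "X \<in> carrier (loc_at n a M (K - {i}))"
  shows "loc_map n M K i X \<in> carrier (loc_at n a M K)"
proof -
  interpret G: graded_localization "S_ring n" M "xmon (K - {i})"
    using loc_at_localization[OF mod, of "K - {i}"] K by blast
  interpret F: graded_localization "S_ring n" M "xmon K"
    using loc_at_localization[OF mod K(1)] .
  let ?v = "var i :: 'k mpoly" and ?g = "xmon (K - {i}) :: 'k mpoly" and ?f = "xmon K :: 'k mpoly"
  have v: "?v \<in> carrier (S_ring n)" using K var_in_S_ring by blast
  have f_eq: "?f = ?v \<otimes>\<^bsub>S_ring n\<^esub> ?g"
    using K finite_subset[OF K(1)] by (simp add: xmon_def S_ring_simps prod.remove)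
  obtain x k where x: "x \<in> carrier M" "X = frac (S_ring n) M ?g x k"
    using X unfolding loc_at_def by (rule localization_cases)
  \<comment> \<open>The exponent \<open>m + k\<close> of \<open>x_i\<close> is the same on both
    sides of a relation, because \<open>p + l + k = p + k + l\<close>; what remains is the given
    relation for \<open>x_(K - {i})\<close>.\<close>
  have vf: "?f [^]\<^bsub>S_ring n\<^esub> m \<odot>\<^bsub>M\<^esub> (?v [^]\<^bsub>S_ring n\<^esub> k \<odot>\<^bsub>M\<^esub> y) =
      ?v [^]\<^bsub>S_ring n\<^esub> (m + k) \<odot>\<^bsub>M\<^esub> (?g [^]\<^bsub>S_ring n\<^esub> m \<odot>\<^bsub>M\<^esub> y)"
    if "y \<in> carrier M" for m k :: nat and y
  proof -
    have "?f [^]\<^bsub>S_ring n\<^esub> m \<otimes>\<^bsub>S_ring n\<^esub> ?v [^]\<^bsub>S_ring n\<^esub> k = ?v [^]\<^bsub>S_ring n\<^esub> (m + k) \<otimes>\<^bsub>S_ring n\<^esub> ?g [^]\<^bsub>S_ring n\<^esub> m"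
      unfolding f_eq by (simp add: S_ring_nat_pow S_ring_simps power_add power_mult_distrib mult_ac)
    then show ?thesis
      using G.smult_assoc1[OF G.R.nat_pow_closed[OF F.f, of m] G.R.nat_pow_closed[OF v, of k] that]
        G.smult_assoc1[OF G.R.nat_pow_closed[OF v, of "m + k"] G.R.nat_pow_closed[OF G.f, of m] that]
      by simp
  qed
  have "(\<lambda>(x, k). frac (S_ring n) M ?f (?v [^]\<^bsub>S_ring n\<^esub> k \<odot>\<^bsub>M\<^esub> x) k) respects loc_rel (S_ring n) M ?g"
  proof (rule congruentI)
    fix Y Z assume "(Y, Z) \<in> loc_rel (S_ring n) M ?g"
    then obtain y k z l p where YZ: "Y = (y, k)" "Z = (z, l)" "y \<in> carrier M" "z \<in> carrier M"
      and p: "?g [^]\<^bsub>S_ring n\<^esub> (p + l) \<odot>\<^bsub>M\<^esub> y = ?g [^]\<^bsub>S_ring n\<^esub> (p + k) \<odot>\<^bsub>M\<^esub> z"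
      by (auto simp: loc_rel_def)
    have "?f [^]\<^bsub>S_ring n\<^esub> (p + l) \<odot>\<^bsub>M\<^esub> (?v [^]\<^bsub>S_ring n\<^esub> k \<odot>\<^bsub>M\<^esub> y) =
        ?f [^]\<^bsub>S_ring n\<^esub> (p + k) \<odot>\<^bsub>M\<^esub> (?v [^]\<^bsub>S_ring n\<^esub> l \<odot>\<^bsub>M\<^esub> z)"
      unfolding vf[OF YZ(3)] vf[OF YZ(4)] p by (simp add: ac_simps)
    then have "frac (S_ring n) M ?f (?v [^]\<^bsub>S_ring n\<^esub> k \<odot>\<^bsub>M\<^esub> y) k =
        frac (S_ring n) M ?f (?v [^]\<^bsub>S_ring n\<^esub> l \<odot>\<^bsub>M\<^esub> z) l"
      using v YZ F.f by (intro G.frac_eqI[of _ _ _ p]) simp_all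
    then show "(case Y of (x, k) \<Rightarrow> frac (S_ring n) M ?f (?v [^]\<^bsub>S_ring n\<^esub> k \<odot>\<^bsub>M\<^esub> x) k) =
        (case Z of (x, k) \<Rightarrow> frac (S_ring n) M ?f (?v [^]\<^bsub>S_ring n\<^esub> k \<odot>\<^bsub>M\<^esub> x) k)"
      by (simp add: YZ)
  qed
  from UN_equiv_class[OF G.loc_rel_equiv[OF G.f] this, of "(x, k)"] x
  have "loc_map n M K i X = frac (S_ring n) M ?f (?v [^]\<^bsub>S_ring n\<^esub> k \<odot>\<^bsub>M\<^esub> x) k"
    by (simp add: loc_map_def frac_def S_ring_nat_pow)
  then show ?thesis using v x unfolding loc_at_def by (simp add: F.frac_in_localization)
qed

section \<open>Coboundaries and the scalars 0 and 1 on cohomology\<close>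

lemma grade_localization_subset:
  assumes "\<And>d. grade M d \<subseteq> carrier M"
  shows "grade (localization R M f w) d \<subseteq> carrier (localization R M f w)"
  using assms by (force simp: localization_def frac_def intro: quotientI)

text \<open>A cohomology class is a coset of the coboundaries, so these too must be families of
  genuine fractions before componentwise laws apply to them. The degree \<open>j\<close> can be
  forgotten, as those laws hold for fractions of every degree.\<close>

lemma cech_boundaries_subset:
  assumes mod: "Module.module (S_ring n) M" and gr: "\<And>d. grade M d \<subseteq> carrier M"
    and \<I>: "\<I> \<subseteq> Pow {..n}"
  shows "cech_boundaries n a M \<I> p j \<subseteq> (\<Pi>\<^sub>E I\<in>{I \<in> \<I>. card I = p}. carrier (loc_at n a M I))"
proof (cases p)
  case 0
  have "\<zero>\<^bsub>loc_at n a M I\<^esub> \<in> carrier (loc_at n a M I)" if "I \<in> \<I>" for I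
  proof -
    interpret F: graded_localization "S_ring n" M "xmon I"
      using loc_at_localization[OF mod, of I] \<I> that by blast
    show ?thesis using abelian_monoid.zero_closed[OF F.localization_abelian_monoid]
      by (simp add: loc_at_def)
  qed
  then show ?thesis by (auto simp: cech_boundaries_def 0 cech_cochains_def Let_def)
next
  case (Suc q)
  have "cech_diff n a M \<I> q c K \<in> carrier (loc_at n a M K)"
    if c: "c \<in> carrier (cech_cochains n a M \<I> q j)" and K: "K \<in> \<I>" "card K = Suc q" for c K
  proof -
    interpret F: graded_localization "S_ring n" M "xmon K"
      using loc_at_localization[OF mod, of K] \<I> K by blast
    interpret A: abelian_monoid "loc_at n a M K"
      using F.localization_abelian_monoid by (simp add: loc_at_def)
    have "c (K - {i}) \<in> carrier (loc_at n a M (K - {i}))" if "i \<in> K" "K - {i} \<in> \<I>" for i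
    proof -
      have "card (K - {i}) = q" using K that by simp
      then have "c (K - {i}) \<in> grade (loc_at n a M (K - {i})) j"
        using c that by (auto simp: cech_cochains_def Let_def)
      then show ?thesis using grade_localization_subset[OF gr] unfolding loc_at_def by blast
    qed
    have "scalar s \<odot>\<^bsub>loc_at n a M K\<^esub> loc_map n M K i (c (K - {i})) \<in> carrier (loc_at n a M K)"
      if "i \<in> K" "K - {i} \<in> \<I>" for i s
    proof -
      have "loc_map n M K i (c (K - {i})) \<in> carrier (loc_at n a M K)"
        using that K \<I> \<open>\<And>i. i \<in> K \<Longrightarrow> K - {i} \<in> \<I> \<Longrightarrow> c (K - {i}) \<in> carrier (loc_at n a M (K - {i}))\<close>
        by (intro loc_map_closed[OF mod]) auto
      then show ?thesis
        unfolding loc_at_def by (intro F.localization_smult_closed scalar_in_S_ring)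
    qed
    then show ?thesis
      using K by (auto simp: cech_diff_def intro!: A.finsum_closed)
  qed
  moreover have "cech_diff n a M \<I> q c \<in> extensional {K \<in> \<I>. card K = Suc q}" for c
    by (simp add: cech_diff_def)
  ultimately show ?thesis
    unfolding cech_boundaries_def Suc nat.case by (intro image_subsetI) (simp add: PiE_iff)
qed

text \<open>The zero of a quotient is the subgroup divided by, so the assumption \<open>ab\<close> supplies the closure
  properties of the coboundaries.\<close>

lemma cech_cohomology_smult:
  fixes M :: "('k::field mpoly, 'm, int) graded"
  assumes mod: "Module.module (S_ring n) M" and gr: "\<And>d. grade M d \<subseteq> carrier M"
    and \<I>: "\<I> \<subseteq> Pow {..n}" and ab: "abelian_group (cech_cohomology n a M \<I> p j)"
    and v: "v \<in> carrier (cech_cohomology n a M \<I> p j)"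
  shows "1 \<odot>\<^bsub>cech_cohomology n a M \<I> p j\<^esub> v = v"
    "0 \<odot>\<^bsub>cech_cohomology n a M \<I> p j\<^esub> v = \<zero>\<^bsub>cech_cohomology n a M \<I> p j\<^esub>"
proof -
  define V where "V = cech_cohomology n a M \<I> p j"
  define N where "N = cech_cochains n a M \<I> p j"
  define H where "H = cech_boundaries n a M \<I> p j"
  define J where "J = {I \<in> \<I>. card I = p}"
  \<comment> \<open>The full product of the localizations contains cochains and coboundaries alike;
    the laws are checked there component by component.\<close>
  define P where "P = (\<Pi>\<^sub>E I\<in>J. carrier (loc_at n a M I))"
  interpret V: abelian_group V using ab by (simp add: V_def)
  have loc: "graded_localization (S_ring n) M (xmon I)" if "I \<in> J" for I
    using loc_at_localization[OF mod, of I] \<I> that by (auto simp: J_def)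
  have locm: "abelian_monoid (loc_at n a M I)" if "I \<in> J" for I
    using graded_localization.localization_abelian_monoid[OF loc[OF that]] by (simp add: loc_at_def)
  have add: "x \<oplus>\<^bsub>N\<^esub> y = (\<lambda>I\<in>J. x I \<oplus>\<^bsub>loc_at n a M I\<^esub> y I)" for x y
    by (simp add: N_def cech_cochains_def J_def Let_def)
  have zero: "\<zero>\<^bsub>N\<^esub> = (\<lambda>I\<in>J. \<zero>\<^bsub>loc_at n a M I\<^esub>)"
    by (simp add: N_def cech_cochains_def J_def Let_def)
  have smult: "s \<odot>\<^bsub>N\<^esub> y = (\<lambda>I\<in>J. scalar s \<odot>\<^bsub>loc_at n a M I\<^esub> y I)" for s y
    by (simp add: N_def cech_cochains_def J_def Let_def)
  have N_P: "carrier N \<subseteq> P"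
    using grade_localization_subset[OF gr] by (fastforce simp: N_def P_def cech_cochains_def J_def loc_at_def Let_def)
  have H_P: "H \<subseteq> P"
    using cech_boundaries_subset[OF mod gr \<I>] by (simp add: H_def P_def J_def)
  have P_add: "x \<oplus>\<^bsub>N\<^esub> y \<in> P" if "x \<in> P" "y \<in> P" for x y
    using that by (auto simp: add P_def intro!: abelian_monoid.a_closed[OF locm] dest: PiE_mem)
  have P_one: "1 \<odot>\<^bsub>N\<^esub> y = y" if "y \<in> P" for y
  proof
    fix I show "(1 \<odot>\<^bsub>N\<^esub> y) I = y I"
    proof (cases "I \<in> J")
      case True
      then have "y I \<in> carrier (loc_at n a M I)" using that by (auto simp: P_def)
      then show ?thesis
        using True graded_localization.localization_one_smult[OF loc[OF True]]
        by (simp add: smult loc_at_def scalar_def S_ring_simps)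
    qed (use that in \<open>auto simp: P_def smult PiE_def extensional_def\<close>)
  qed
  have P_zero: "0 \<odot>\<^bsub>N\<^esub> y = \<zero>\<^bsub>N\<^esub>" if "y \<in> P" for y
  proof
    fix I show "(0 \<odot>\<^bsub>N\<^esub> y) I = \<zero>\<^bsub>N\<^esub> I"
    proof (cases "I \<in> J")
      case True
      then have "y I \<in> carrier (loc_at n a M I)" using that by (auto simp: P_def)
      then show ?thesis
        using True graded_localization.localization_zero_smult[OF loc[OF True]]
        by (simp add: smult loc_at_def scalar_def zero S_ring_simps)
    qed (simp add: smult zero)
  qed
  have P_right: "h \<oplus>\<^bsub>N\<^esub> \<zero>\<^bsub>N\<^esub> = h" if "h \<in> P" for h
  proof
    fix I show "(h \<oplus>\<^bsub>N\<^esub> \<zero>\<^bsub>N\<^esub>) I = h I"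
    proof (cases "I \<in> J")
      case True
      then show ?thesis using that abelian_monoid.r_zero[OF locm[OF True]]
        by (auto simp: P_def add zero)
    qed (use that in \<open>auto simp: P_def add PiE_def extensional_def\<close>)
  qed
  have H: "\<zero>\<^bsub>V\<^esub> = H"
    by (simp add: V_def cech_cohomology_def quot_module_def H_def)
  have V_add: "X \<oplus>\<^bsub>V\<^esub> Y = {x \<oplus>\<^bsub>N\<^esub> y | x y. x \<in> X \<and> y \<in> Y}" for X Y
    by (auto simp: V_def cech_cohomology_def quot_module_def N_def set_add_def')
  have V_smult: "s \<odot>\<^bsub>V\<^esub> X = H \<oplus>\<^bsub>V\<^esub> ((\<odot>\<^bsub>N\<^esub>) s ` X)" for s X
    by (auto simp: V_def cech_cohomology_def quot_module_def N_def set_add_def' H_def)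
  have vV: "v \<in> carrier V" using v by (simp add: V_def)
  then obtain x where x: "x \<in> carrier N" and vx: "v = {h \<oplus>\<^bsub>N\<^esub> x | h. h \<in> H}"
    by (auto simp: V_def cech_cohomology_def quot_module_def N_def H_def A_RCOSETS_def' a_r_coset_def')
  have v_P: "v \<subseteq> P" using vx x N_P H_P P_add by blast
  have "(\<odot>\<^bsub>N\<^esub>) 1 ` v = v" using v_P P_one by force
  then show "1 \<odot>\<^bsub>cech_cohomology n a M \<I> p j\<^esub> v = v"
    using vV by (simp add: V_smult flip: V_def) (simp flip: H)
  have "0 \<odot>\<^bsub>V\<^esub> v = H"
  \<comment> \<open>An empty coset forces \<open>H\<close> to be empty, and then both sides are
    empty. Otherwise the image of \<open>v\<close> under \<open>0\<close> is the single zero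
    cochain.\<close>
  proof (cases "v = {}")
    case True
    then show ?thesis using vx by (auto simp: V_smult V_add)
  next
    case False
    then have "(\<odot>\<^bsub>N\<^esub>) 0 ` v = {\<zero>\<^bsub>N\<^esub>}"
      using v_P P_zero by (metis (no_types, lifting) image_cong image_constant_conv subset_iff)
    then have "0 \<odot>\<^bsub>V\<^esub> v = (\<lambda>h. h \<oplus>\<^bsub>N\<^esub> \<zero>\<^bsub>N\<^esub>) ` H" by (auto simp: V_smult V_add)
    also have "\<dots> = (\<lambda>h. h) ` H" using H_P P_right by (intro image_cong) auto
    finally show ?thesis by simp
  qed
  then show "0 \<odot>\<^bsub>cech_cohomology n a M \<I> p j\<^esub> v = \<zero>\<^bsub>cech_cohomology n a M \<I> p j\<^esub>"
    by (simp add: H flip: V_def)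
qed

section \<open>Graded homomorphisms\<close>

lemma (in right_module) smult_zero:
  assumes "e \<in> carrier R" shows "e \<odot>\<^bsub>M\<^esub> \<zero>\<^bsub>M\<^esub> = \<zero>\<^bsub>M\<^esub>"
  using smult_r_distr[of e "\<zero>\<^bsub>M\<^esub>" "\<zero>\<^bsub>M\<^esub>"] smult_closed[of e "\<zero>\<^bsub>M\<^esub>"] assms by simp

lemma (in right_module) smult_minus:
  assumes e: "e \<in> carrier R" and x: "x \<in> carrier M"
  shows "e \<odot>\<^bsub>M\<^esub> (\<ominus>\<^bsub>M\<^esub> x) = \<ominus>\<^bsub>M\<^esub> (e \<odot>\<^bsub>M\<^esub> x)"
proof -
  have "e \<odot>\<^bsub>M\<^esub> (\<ominus>\<^bsub>M\<^esub> x) \<oplus>\<^bsub>M\<^esub> e \<odot>\<^bsub>M\<^esub> x = \<zero>\<^bsub>M\<^esub>"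
    using e x smult_r_distr[of e "\<ominus>\<^bsub>M\<^esub> x" x] by (simp add: M.l_neg smult_zero)
  then show ?thesis using e x smult_closed by (simp add: M.minus_equality)
qed

lemma graded_E_hom_zero:
  assumes f: "graded_E_hom n D D' p f" and "abelian_group D" "abelian_group D'"
  shows "f \<zero>\<^bsub>D\<^esub> = \<zero>\<^bsub>D'\<^esub>"
proof -
  interpret D: abelian_group D by fact
  interpret D': abelian_group D' by fact
  have closed: "f \<zero>\<^bsub>D\<^esub> \<in> carrier D'"
    and add: "\<forall>x\<in>carrier D. \<forall>y\<in>carrier D. f (x \<oplus>\<^bsub>D\<^esub> y) = f x \<oplus>\<^bsub>D'\<^esub> f y"
    using f by (auto simp: graded_E_hom_def split_beta)
  from add[rule_format, of "\<zero>\<^bsub>D\<^esub>" "\<zero>\<^bsub>D\<^esub>"] closed show ?thesis by simp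
qed

lemma graded_E_hom_finsum:
  assumes f: "graded_E_hom n D D' p f" and D: "abelian_group D" and D': "abelian_group D'"
    and c: "c \<in> A \<rightarrow> carrier D"
  shows "f (finsum D c A) = finsum D' (\<lambda>x. f (c x)) A"
proof -
  interpret D: abelian_group D by fact
  interpret D': abelian_group D' by fact
  note zero = graded_E_hom_zero[OF f D D']
  have f': "\<And>x. x \<in> carrier D \<Longrightarrow> f x \<in> carrier D'"
    "\<And>x y. x \<in> carrier D \<Longrightarrow> y \<in> carrier D \<Longrightarrow> f (x \<oplus>\<^bsub>D\<^esub> y) = f x \<oplus>\<^bsub>D'\<^esub> f y"
    using f by (auto simp: graded_E_hom_def split_beta)
  show ?thesis
  proof (cases "finite A")
    case True
    then show ?thesis using c
    proof (induction A)
      case (insert x A)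
      then have "c x \<in> carrier D" "c \<in> A \<rightarrow> carrier D" by auto
      then have "finsum D c A \<in> carrier D" "(\<lambda>x. f (c x)) \<in> A \<rightarrow> carrier D'"
        by (auto intro: f' D.finsum_closed)
      then show ?case using insert by (auto simp: f')
    qed (simp add: zero)
  qed (simp add: zero)
qed

lemma internal_direct_sum_subgroup: "internal_direct_sum D G \<Longrightarrow> subgroup (G p) (add_monoid D)"
  unfolding internal_direct_sum_def by blast

text \<open>The inverse preserves degrees because the homogeneous components of the preimage of a
  homogeneous element map to its homogeneous components.\<close>

lemma graded_E_iso_inv:
  fixes D :: "(nat set \<Rightarrow> 'k::field, 'm, int \<times> int, 'x) graded_scheme"
    and D' :: "(nat set \<Rightarrow> 'k, 'l, int \<times> int, 'y) graded_scheme"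
  assumes iso: "graded_E_iso n a D D' f"
  shows "graded_E_hom n D' D (0, 0) (inv_into (carrier D) f)"
proof -
  let ?g = "inv_into (carrier D) f"
  have D: "graded_E_module n a D" and D': "graded_E_module n a D'"
    and f: "graded_E_hom n D D' (0, 0) f" and bij: "bij_betw f (carrier D) (carrier D')"
    using iso by (auto simp: graded_E_iso_def)
  interpret D: right_module "E_ring n" D using D by (simp add: graded_E_module_def)
  interpret D': right_module "E_ring n" D' using D' by (simp add: graded_E_module_def)
  have sumD: "internal_direct_sum D (grade D)" and sumD': "internal_direct_sum D' (grade D')"
    using D D' by (auto simp: graded_E_module_def)
  have inj: "inj_on f (carrier D)" using bij by (simp add: bij_betw_def)
  have g: "?g y \<in> carrier D" "f (?g y) = y" if "y \<in> carrier D'" for y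
    using bij that by (auto simp: bij_betw_def f_inv_into_f inv_into_into)
  have gf: "?g (f x) = x" if "x \<in> carrier D" for x
    using inj that by simp
  have f': "\<And>x. x \<in> carrier D \<Longrightarrow> f x \<in> carrier D'"
    "\<And>x y. x \<in> carrier D \<Longrightarrow> y \<in> carrier D \<Longrightarrow> f (x \<oplus>\<^bsub>D\<^esub> y) = f x \<oplus>\<^bsub>D'\<^esub> f y"
    "\<And>e x. e \<in> carrier (E_ring n) \<Longrightarrow> x \<in> carrier D \<Longrightarrow> f (e \<odot>\<^bsub>D\<^esub> x) = e \<odot>\<^bsub>D'\<^esub> f x"
    using f by (auto simp: graded_E_hom_def)
  have f_grade: "f x \<in> grade D' p" if "x \<in> grade D p" for p x
    using f that by (cases p) (auto simp: graded_E_hom_def image_subset_iff)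
  have f0: "f \<zero>\<^bsub>D\<^esub> = \<zero>\<^bsub>D'\<^esub>"
    using graded_E_hom_zero[OF f] D.M.abelian_group_axioms D'.M.abelian_group_axioms by blast
  have sub: "grade D p \<subseteq> carrier D" "grade D' p \<subseteq> carrier D'" for p
    using internal_direct_sum_subgroup[OF sumD, THEN subgroup.subset]
      internal_direct_sum_subgroup[OF sumD', THEN subgroup.subset] by simp_all
  have zero_grade: "\<zero>\<^bsub>D\<^esub> \<in> grade D p" "\<zero>\<^bsub>D'\<^esub> \<in> grade D' p" for p
    using internal_direct_sum_subgroup[OF sumD, THEN subgroup.one_closed]
      internal_direct_sum_subgroup[OF sumD', THEN subgroup.one_closed] by simp_all
  have grade: "?g y \<in> grade D p" if y: "y \<in> grade D' p" for y p
  proof -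
    have y': "y \<in> carrier D'" using y sub by blast
    obtain c where c: "\<forall>i. c i \<in> grade D i" "finite {i. c i \<noteq> \<zero>\<^bsub>D\<^esub>}"
      and gy: "?g y = finsum D c {i. c i \<noteq> \<zero>\<^bsub>D\<^esub>}"
      using sumD g(1)[OF y'] by (fastforce simp: internal_direct_sum_def)
    have c_car: "c i \<in> carrier D" for i using c sub by blast
    \<comment> \<open>By injectivity \<open>f\<close> sends nonzero components to nonzero ones, so
      the mapped family has the same support and is a legitimate decomposition of
      \<open>y\<close>.\<close>
    have supp: "{i. f (c i) \<noteq> \<zero>\<^bsub>D'\<^esub>} = {i. c i \<noteq> \<zero>\<^bsub>D\<^esub>}"
      using inj_onD[OF inj] c_car f0 D.M.zero_closed by (metis (no_types, lifting))
    have "y = finsum D' (\<lambda>i. f (c i)) {i. c i \<noteq> \<zero>\<^bsub>D\<^esub>}"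
      using graded_E_hom_finsum[OF f D.M.abelian_group_axioms D'.M.abelian_group_axioms, of c] c_car gy g(2)[OF y']
      by auto
    then have 1: "(\<forall>i. f (c i) \<in> grade D' i) \<and> finite {i. f (c i) \<noteq> \<zero>\<^bsub>D'\<^esub>} \<and>
        y = finsum D' (\<lambda>i. f (c i)) {i. f (c i) \<noteq> \<zero>\<^bsub>D'\<^esub>}"
      using c f_grade by (simp add: supp)
    \<comment> \<open>The competing decomposition has \<open>y\<close> itself in degree
      \<open>p\<close> and zero elsewhere; its support is \<open>{p}\<close>, or empty if
      \<open>y\<close> is zero.\<close>
    let ?d = "\<lambda>i. if i = p then y else \<zero>\<^bsub>D'\<^esub>"
    have "y = finsum D' ?d {i. ?d i \<noteq> \<zero>\<^bsub>D'\<^esub>}"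
    proof (cases "y = \<zero>\<^bsub>D'\<^esub>")
      case False
      then have "{i. ?d i \<noteq> \<zero>\<^bsub>D'\<^esub>} = {p}" by auto
      then show ?thesis using y' by simp
    qed simp
    moreover have "finite {i. ?d i \<noteq> \<zero>\<^bsub>D'\<^esub>}"
      by (rule finite_subset[of _ "{p}"]) auto
    ultimately have 2: "(\<forall>i. ?d i \<in> grade D' i) \<and> finite {i. ?d i \<noteq> \<zero>\<^bsub>D'\<^esub>} \<and>
        y = finsum D' ?d {i. ?d i \<noteq> \<zero>\<^bsub>D'\<^esub>}"
      using y zero_grade by simp
    have "\<exists>!c. (\<forall>i. c i \<in> grade D' i) \<and> finite {i. c i \<noteq> \<zero>\<^bsub>D'\<^esub>} \<and>
        y = finsum D' c {i. c i \<noteq> \<zero>\<^bsub>D'\<^esub>}"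
      using sumD' y' unfolding internal_direct_sum_def by (elim conjE ballE) auto
    then obtain c' where "\<forall>c. (\<forall>i. c i \<in> grade D' i) \<and> finite {i. c i \<noteq> \<zero>\<^bsub>D'\<^esub>} \<and>
        y = finsum D' c {i. c i \<noteq> \<zero>\<^bsub>D'\<^esub>} \<longrightarrow> c = c'"
      by (elim ex1E)
    \<comment> \<open>Uniqueness of homogeneous components identifies the two families, so the
      preimage of \<open>y\<close> is \<open>c p\<close>, which has degree \<open>p\<close>.\<close>
    from this[rule_format, OF 1] this[rule_format, OF 2] have "(\<lambda>i. f (c i)) = ?d" by (simp only:)
    from fun_cong[OF this, of p] have "f (c p) = y" by simp
    then show ?thesis using gf[OF c_car] c by metis
  qed
  show ?thesis
    unfolding graded_E_hom_def split
  proof (intro conjI ballI allI)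
    show "?g \<in> carrier D' \<rightarrow> carrier D" using g by auto
    fix x y assume "x \<in> carrier D'" "y \<in> carrier D'"
    then show "?g (x \<oplus>\<^bsub>D'\<^esub> y) = ?g x \<oplus>\<^bsub>D\<^esub> ?g y"
      using gf[of "?g x \<oplus>\<^bsub>D\<^esub> ?g y"] by (simp add: g f')
  next
    fix e :: "nat set \<Rightarrow> 'k" and x assume "e \<in> carrier (E_ring n)" "x \<in> carrier D'"
    then show "?g (e \<odot>\<^bsub>D'\<^esub> x) = e \<odot>\<^bsub>D\<^esub> ?g x"
      using gf[of "e \<odot>\<^bsub>D\<^esub> ?g x"] by (simp add: g f' D.smult_closed)
  next
    fix d t show "?g ` grade D' (d, t) \<subseteq> grade D (0 + d, 0 + t)" using grade by auto
  qed
qed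

lemma graded_E_hom_comp:
  assumes f: "graded_E_hom n D D' (c, s) f" and g: "graded_E_hom n D' D'' (c', s') g"
  shows "graded_E_hom n D D'' (c' + c, s' + s) (g \<circ> f)"
proof -
  have "(g \<circ> f) ` grade D (d, t) \<subseteq> grade D'' (c' + c + d, s' + s + t)" for d t
  proof -
    have "f ` grade D (d, t) \<subseteq> grade D' (c + d, s + t)"
      "g ` grade D' (c + d, s + t) \<subseteq> grade D'' (c' + (c + d), s' + (s + t))"
      using f g by (auto simp: graded_E_hom_def)
    then show ?thesis by (fastforce simp: add.assoc)
  qed
  then show ?thesis using f g by (fastforce simp: graded_E_hom_def Pi_iff)
qed

text \<open>A Tate resolution is a cone, and this is how linearity and the degree of its
  differential are obtained. The degree \<open>(0;0)\<close> map \<open>f\<close> becomes an entry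
  of degree \<open>(0;-1)\<close> because its source is twisted.\<close>

lemma cone_diff_hom:
  assumes F: "differential_module n a F" and D: "differential_module n a D"
    and f: "diff_morphism n F D f"
  shows "graded_E_hom n (cone F D f) (cone F D f) (0, - 1) (diff (cone F D f))"
proof -
  have gF: "graded_E_module n a F" and gD: "graded_E_module n a D"
    using F D by (auto simp: differential_module_def)
  interpret F: right_module "E_ring n" F using gF by (simp add: graded_E_module_def)
  interpret D: right_module "E_ring n" D using gD by (simp add: graded_E_module_def)
  have sg: "subgroup (grade F p) (add_monoid F)" "subgroup (grade D p) (add_monoid D)" for p
    using gF gD by (auto simp: graded_E_module_def intro: internal_direct_sum_subgroup)
  have neg: "x \<in> grade F p \<Longrightarrow> \<ominus>\<^bsub>F\<^esub> x \<in> grade F p" for x p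
    using subgroup.m_inv_closed[OF sg(1)] by (simp add: a_inv_def)
  have add: "x \<in> grade D p \<Longrightarrow> y \<in> grade D p \<Longrightarrow> x \<oplus>\<^bsub>D\<^esub> y \<in> grade D p" for x y p
    using subgroup.m_closed[OF sg(2)] by simp
  have dF: "\<And>x. x \<in> carrier F \<Longrightarrow> diff F x \<in> carrier F"
    "\<And>x y. x \<in> carrier F \<Longrightarrow> y \<in> carrier F \<Longrightarrow> diff F (x \<oplus>\<^bsub>F\<^esub> y) = diff F x \<oplus>\<^bsub>F\<^esub> diff F y"
    "\<And>e x. e \<in> carrier (E_ring n) \<Longrightarrow> x \<in> carrier F \<Longrightarrow> diff F (e \<odot>\<^bsub>F\<^esub> x) = e \<odot>\<^bsub>F\<^esub> diff F x"
    "\<And>d t x. x \<in> grade F (d, t) \<Longrightarrow> diff F x \<in> grade F (d, t - 1)"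
    using F by (auto simp: differential_module_def graded_E_hom_def image_subset_iff)
  have dD: "\<And>x. x \<in> carrier D \<Longrightarrow> diff D x \<in> carrier D"
    "\<And>x y. x \<in> carrier D \<Longrightarrow> y \<in> carrier D \<Longrightarrow> diff D (x \<oplus>\<^bsub>D\<^esub> y) = diff D x \<oplus>\<^bsub>D\<^esub> diff D y"
    "\<And>e x. e \<in> carrier (E_ring n) \<Longrightarrow> x \<in> carrier D \<Longrightarrow> diff D (e \<odot>\<^bsub>D\<^esub> x) = e \<odot>\<^bsub>D\<^esub> diff D x"
    "\<And>d t x. x \<in> grade D (d, t) \<Longrightarrow> diff D x \<in> grade D (d, t - 1)"
    using D by (auto simp: differential_module_def graded_E_hom_def image_subset_iff)
  have f': "\<And>x. x \<in> carrier F \<Longrightarrow> f x \<in> carrier D"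
    "\<And>x y. x \<in> carrier F \<Longrightarrow> y \<in> carrier F \<Longrightarrow> f (x \<oplus>\<^bsub>F\<^esub> y) = f x \<oplus>\<^bsub>D\<^esub> f y"
    "\<And>e x. e \<in> carrier (E_ring n) \<Longrightarrow> x \<in> carrier F \<Longrightarrow> f (e \<odot>\<^bsub>F\<^esub> x) = e \<odot>\<^bsub>D\<^esub> f x"
    "\<And>d t x. x \<in> grade F (d, t) \<Longrightarrow> f x \<in> grade D (d, t)"
    using f by (auto simp: diff_morphism_def graded_E_hom_def image_subset_iff)
  have "diff (cone F D f) (x \<oplus>\<^bsub>cone F D f\<^esub> y) = diff (cone F D f) x \<oplus>\<^bsub>cone F D f\<^esub> diff (cone F D f) y"
    if "x \<in> carrier (cone F D f)" "y \<in> carrier (cone F D f)" for x y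
    using that by (auto simp: cone_def dF dD f' D.M.a_ac F.M.minus_add)
  moreover have "diff (cone F D f) (e \<odot>\<^bsub>cone F D f\<^esub> x) = e \<odot>\<^bsub>cone F D f\<^esub> diff (cone F D f) x"
    if "e \<in> carrier (E_ring n)" "x \<in> carrier (cone F D f)" for e x
    using that by (auto simp: cone_def dF dD f' D.smult_r_distr F.smult_minus)
  moreover have "diff (cone F D f) x \<in> grade (cone F D f) (d, t - 1)" if x: "x \<in> grade (cone F D f) (d, t)" for x d t
  proof -
    \<comment> \<open>The twist by \<open>(0;-1)\<close> places \<open>z\<close> in degree
      \<open>t - 1\<close> of \<open>F\<close>, so \<open>f z\<close> already has the degree
      \<open>t - 1\<close> required in \<open>D\<close>.\<close>
    obtain y z where yz: "x = (y, z)" "y \<in> grade D (d, t)" "z \<in> grade F (d, t - 1)"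
      using x by (auto simp: cone_def twist2_def)
    have "diff D y \<oplus>\<^bsub>D\<^esub> f z \<in> grade D (d, t - 1)" "\<ominus>\<^bsub>F\<^esub> diff F z \<in> grade F (d, t - 1 - 1)"
      by (rule add neg dD(4) dF(4) f'(4) yz)+
    then show ?thesis using yz by (simp add: cone_def twist2_def)
  qed
  moreover have "diff (cone F D f) \<in> carrier (cone F D f) \<rightarrow> carrier (cone F D f)"
    by (auto simp: cone_def dF dD f')
  ultimately show ?thesis by (auto simp: graded_E_hom_def)
qed

section \<open>Direct sums of twists of \<open>\<omega>_E\<close>\<close>

text \<open>The cohomology groups are replaced by an arbitrary family \<open>V\<close>, indexed by
  cohomological degree and twist, so that the degree argument is separated from the Cech
  complex.\<close>

definition omega_sum ::
    "nat \<Rightarrow> (nat \<Rightarrow> nat) \<Rightarrow> (nat \<times> int \<Rightarrow> ('k::field, 'v) module)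
      \<Rightarrow> ('k, nat \<times> int \<Rightarrow> nat set \<Rightarrow> 'v) graded_E" where
  "omega_sum n a V = direct_sum (\<lambda>(i, j). twist2 (- j, int i) (tensor_omega n a (V (i, j))))"

definition emon :: "nat set \<Rightarrow> nat set \<Rightarrow> 'k::field" where
  "emon I = (\<lambda>K. if K = I then 1 else 0)"

lemma omega_sum_alt:
  "omega_sum n a V = direct_sum (\<lambda>p. twist2 (- snd p, int (fst p)) (tensor_omega n a (V p)))"
  by (simp add: omega_sum_def case_prod_unfold)

lemma emon_in_E_deg: "I \<subseteq> {..n} \<Longrightarrow> emon I \<in> E_deg n a (edeg a I)"
  by (auto simp: emon_def E_deg_def E_ring_def)

section \<open>Coordinates and degrees in the direct sum\<close>

locale omega_sum_module =
  fixes n :: nat and a :: "nat \<Rightarrow> nat" and V :: "nat \<times> int \<Rightarrow> ('k::field, 'v) module"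
  assumes graded: "graded_E_module n a (omega_sum n a V)"
begin

abbreviation C where "C \<equiv> omega_sum n a V"

sublocale C: right_module "E_ring n" C
  using graded by (simp add: graded_E_module_def)

lemma carrier_C: "f \<in> carrier C \<longleftrightarrow>
    (\<forall>p I. if I \<subseteq> {..n} then f p I \<in> carrier (V p) else f p I = \<zero>\<^bsub>V p\<^esub>) \<and> finite {p. f p \<noteq> (\<lambda>I. \<zero>\<^bsub>V p\<^esub>)}"
  by (simp add: omega_sum_alt direct_sum_def tensor_omega_def tensor_E_def twist2_def split_beta)

lemma zero_C: "\<zero>\<^bsub>C\<^esub> = (\<lambda>p I. \<zero>\<^bsub>V p\<^esub>)"
  by (simp add: omega_sum_alt direct_sum_def tensor_omega_def tensor_E_def twist2_def split_beta)

lemma add_C: "f \<oplus>\<^bsub>C\<^esub> g = (\<lambda>p I. if I \<subseteq> {..n} then f p I \<oplus>\<^bsub>V p\<^esub> g p I else \<zero>\<^bsub>V p\<^esub>)"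
  by (simp add: omega_sum_alt direct_sum_def tensor_omega_def tensor_E_def twist2_def split_beta)

lemma smult_C: "e \<odot>\<^bsub>C\<^esub> f = (\<lambda>p K. if K \<subseteq> {..n}
    then finsum (V p) (\<lambda>I. (esgn I (K - I) * e (K - I)) \<odot>\<^bsub>V p\<^esub> f p I) (Pow K) else \<zero>\<^bsub>V p\<^esub>)"
  by (simp add: omega_sum_alt direct_sum_def tensor_omega_def tensor_E_def twist2_def split_beta)

text \<open>The right-hand side collects the twists by \<open>(-j;i)\<close> and by the shift in
  \<open>\<omega>_E\<close>. At \<open>I = {}\<close> it gives the degree of the generators of the
  summand \<open>(i, j)\<close>.\<close>

lemma grade_C: "f \<in> grade C (d, t) \<longleftrightarrow> f \<in> carrier C \<and>
    (\<forall>i j I. f (i, j) I \<noteq> \<zero>\<^bsub>V (i, j)\<^esub> \<longrightarrow>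
      edeg a I = (d - j - (\<Sum>i\<le>n. int (a i)), t + int i - int n - 1))"
  unfolding carrier_C
  by (simp add: omega_sum_alt direct_sum_def tensor_omega_def tensor_E_def twist2_def split_beta)
    (simp add: algebra_simps; blast)

lemma grade_C_smult:
  assumes "e \<in> E_deg n a (c, s)" "f \<in> grade C (d, t)"
  shows "e \<odot>\<^bsub>C\<^esub> f \<in> grade C (c + d, s + t)"
  using graded assms by (auto simp: graded_E_module_def)

lemma V_zero_closed: "\<zero>\<^bsub>V p\<^esub> \<in> carrier (V p)"
  using C.M.zero_closed unfolding carrier_C zero_C by (metis empty_subsetI)

lemma C_component: "f \<in> carrier C \<Longrightarrow> f p I \<in> carrier (V p)"
  unfolding carrier_C using V_zero_closed by metis

lemma C_outside: "f \<in> carrier C \<Longrightarrow> \<not> I \<subseteq> {..n} \<Longrightarrow> f p I = \<zero>\<^bsub>V p\<^esub>"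
  unfolding carrier_C by metis

text \<open>The element \<open>v \<otimes> e_I\<close> of the summand \<open>p\<close>; those with
  \<open>I = {}\<close> are the generators over \<open>E\<close>.\<close>

definition single where
  "single p I v = (\<lambda>q J. if q = p \<and> J = I then v else \<zero>\<^bsub>V q\<^esub>)"

lemma single_in_C:
  assumes "I \<subseteq> {..n}" "v \<in> carrier (V p)"
  shows "single p I v \<in> carrier C"
proof -
  have "finite {q. single p I v q \<noteq> (\<lambda>I. \<zero>\<^bsub>V q\<^esub>)}"
    by (rule finite_subset[of _ "{p}"]) (auto simp: single_def)
  then show ?thesis
    unfolding carrier_C using assms V_zero_closed by (auto simp: single_def)
qed

text \<open>Each \<open>V p\<close> appears in the direct sum as the coordinate at \<open>p\<close>
  and \<open>{}\<close>, so its group laws are read off from those of \<open>C\<close>. For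
  cohomology this yields the group structure that the Cech computation of scalars takes as an
  assumption.\<close>

sublocale V: abelian_group "V p" for p
proof (rule abelian_groupI)
  let ?s = "single p {}"
  have s: "?s x p {} = x" and c: "(f \<oplus>\<^bsub>C\<^esub> g) p {} = f p {} \<oplus>\<^bsub>V p\<^esub> g p {}" for x f g
    by (simp_all add: single_def add_C)
  show "\<zero>\<^bsub>V p\<^esub> \<in> carrier (V p)" by (rule V_zero_closed)
  fix x y z assume x: "x \<in> carrier (V p)"
  then have x': "?s x \<in> carrier C" by (simp add: single_in_C)
  show "\<zero>\<^bsub>V p\<^esub> \<oplus>\<^bsub>V p\<^esub> x = x"
    using c[of "\<zero>\<^bsub>C\<^esub>" "?s x"] x' by (simp add: s) (simp add: zero_C)
  show "\<exists>y\<in>carrier (V p). y \<oplus>\<^bsub>V p\<^esub> x = \<zero>\<^bsub>V p\<^esub>"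
    using c[of "\<ominus>\<^bsub>C\<^esub> ?s x" "?s x"] x' C.M.l_neg[OF x'] C_component[OF C.M.a_inv_closed[OF x']]
    by (simp add: s) (metis zero_C)
  assume y: "y \<in> carrier (V p)"
  then have y': "?s y \<in> carrier C" by (simp add: single_in_C)
  show "x \<oplus>\<^bsub>V p\<^esub> y \<in> carrier (V p)"
    using C_component[of "?s x \<oplus>\<^bsub>C\<^esub> ?s y" p "{}"] x' y' by (simp add: c s)
  show "x \<oplus>\<^bsub>V p\<^esub> y = y \<oplus>\<^bsub>V p\<^esub> x"
    using C.M.a_comm[OF x' y'] c[of "?s x" "?s y"] c[of "?s y" "?s x"] by (simp add: s)
  assume "z \<in> carrier (V p)"
  then have z': "?s z \<in> carrier C" by (simp add: single_in_C)
  show "x \<oplus>\<^bsub>V p\<^esub> y \<oplus>\<^bsub>V p\<^esub> z = x \<oplus>\<^bsub>V p\<^esub> (y \<oplus>\<^bsub>V p\<^esub> z)"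
    using arg_cong[OF C.M.a_assoc[OF x' y' z'], of "\<lambda>f. f p {}"] by (simp add: c s)
qed

text \<open>The action on one component depends on that component alone, so it may be compared with
  the action on the zero family, which the module laws determine.\<close>

lemma smult_C_component_zero:
  assumes "e \<in> carrier (E_ring n)" "f p = \<zero>\<^bsub>C\<^esub> p"
  shows "(e \<odot>\<^bsub>C\<^esub> f) p = \<zero>\<^bsub>C\<^esub> p"
proof -
  have "(e \<odot>\<^bsub>C\<^esub> f) p = (e \<odot>\<^bsub>C\<^esub> \<zero>\<^bsub>C\<^esub>) p" by (simp only: smult_C assms(2))
  then show ?thesis using assms(1) by (simp add: C.smult_zero)
qed

lemma single_in_grade:
  assumes "v \<in> carrier (V (i, j))"
  shows "single (i, j) {} v \<in> grade C ((\<Sum>i\<le>n. int (a i)) + j, int n + 1 - int i)"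
  using single_in_C[of "{}" v "(i, j)"] assms
  by (auto simp: grade_C) (auto simp: single_def edeg_def split: if_splits)

end

text \<open>For the cohomology groups these two laws are inherited from the localizations; they
  evaluate the action of \<open>e_I\<close> on a generator.\<close>

locale omega_sum_unital = omega_sum_module +
  assumes V_one: "v \<in> carrier (V p) \<Longrightarrow> 1 \<odot>\<^bsub>V p\<^esub> v = v"
    and V_zero: "v \<in> carrier (V p) \<Longrightarrow> 0 \<odot>\<^bsub>V p\<^esub> v = \<zero>\<^bsub>V p\<^esub>"
begin

text \<open>Homogeneity disposes of the coordinates at which signs would enter, so only the scalars
  \<open>0\<close> and \<open>1\<close> act.\<close>

lemma emon_smult_single:
  assumes I: "I \<subseteq> {..n}" and v: "v \<in> carrier (V p)"
  shows "emon I \<odot>\<^bsub>C\<^esub> single p {} v = single p I v"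
proof (intro ext)
  fix q K
  obtain i j where p: "p = (i, j)" by (cases p)
  have e: "emon I \<in> carrier (E_ring n)" using emon_in_E_deg[OF I] by (auto simp: E_deg_def)
  let ?g = "emon I \<odot>\<^bsub>C\<^esub> single p {} v"
  have "emon I \<in> E_deg n a (fst (edeg a I), snd (edeg a I))"
    using emon_in_E_deg[OF I] by simp
  from grade_C_smult[OF this single_in_grade] v p
  have grade: "?g \<in> grade C (fst (edeg a I) + ((\<Sum>i\<le>n. int (a i)) + j), snd (edeg a I) + (int n + 1 - int i))"
    by simp
  consider "q \<noteq> p" | "\<not> K \<subseteq> {..n}" | "q = p" "edeg a K \<noteq> edeg a I"
    | "q = p" "K \<subseteq> {..n}" "edeg a K = edeg a I" by blast
  then show "?g q K = single p I v q K"
  proof cases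
    case 1
    then have "single p {} v q = \<zero>\<^bsub>C\<^esub> q" by (simp add: single_def zero_C)
    from smult_C_component_zero[where f = "single p {} v" and p = q, OF e this] 1 show ?thesis by (simp add: single_def zero_C)
  next
    case 2
    then show ?thesis using I by (auto simp: smult_C single_def)
  next
    case 3
    have "?g (i, j) K = \<zero>\<^bsub>V (i, j)\<^esub>"
      by (rule ccontr) (use grade 3 in \<open>auto simp: grade_C prod_eq_iff\<close>)
    then have "?g q K = \<zero>\<^bsub>V q\<^esub>" using 3 p by simp
    then show ?thesis using 3 by (auto simp: single_def)
  next
    case 4
    then have fin: "finite K" and card: "card K = card I"
      using finite_subset by (auto simp: edeg_def)
    \<comment> \<open>Since \<open>K\<close> and \<open>I\<close> have equally many elements,
      \<open>K - J = I\<close> forces \<open>J = {}\<close> and \<open>K = I\<close>; the sign there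
      is \<open>esgn {} K = 1\<close>.\<close>
    have summand: "(esgn J (K - J) * emon I (K - J)) \<odot>\<^bsub>V p\<^esub> single p {} v p J =
        (if {} = J then if K = I then v else \<zero>\<^bsub>V p\<^esub> else \<zero>\<^bsub>V p\<^esub>)" if "J \<subseteq> K" for J
    proof (cases "J = {}")
      case True
      then show ?thesis using v V_one V_zero by (simp add: emon_def single_def)
    next
      case False
      have "card (K - J) < card K"
        using that fin False by (intro psubset_card_mono) auto
      then have "K - J \<noteq> I" using card by auto
      then show ?thesis using False V_zero V_zero_closed by (simp add: emon_def single_def)
    qed
    have "?g q K = finsum (V p) (\<lambda>J. (esgn J (K - J) * emon I (K - J)) \<odot>\<^bsub>V p\<^esub> single p {} v p J) (Pow K)"
      using 4 by (simp add: smult_C)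
    also have "\<dots> = finsum (V p) (\<lambda>J. if {} = J then if K = I then v else \<zero>\<^bsub>V p\<^esub> else \<zero>\<^bsub>V p\<^esub>) (Pow K)"
      using v by (intro V.finsum_cong' refl) (auto simp only: summand Pow_iff Pi_iff V_zero_closed split: if_split)
    also have "\<dots> = (if K = I then v else \<zero>\<^bsub>V p\<^esub>)"
      using fin v by (intro V.finsum_singleton) auto
    finally show ?thesis using 4 by (simp add: single_def)
  qed
qed

section \<open>Finite support and strands\<close>

definition restr where
  "restr A f = (\<lambda>p I. if (p, I) \<in> A then f p I else \<zero>\<^bsub>V p\<^esub>)"

lemma restr_in_C:
  assumes "f \<in> carrier C"
  shows "restr A f \<in> carrier C"
proof -
  have "finite {p. restr A f p \<noteq> (\<lambda>I. \<zero>\<^bsub>V p\<^esub>)}"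
    by (rule finite_subset[of _ "{p. f p \<noteq> (\<lambda>I. \<zero>\<^bsub>V p\<^esub>)}"])
      (use assms in \<open>auto simp: carrier_C restr_def fun_eq_iff\<close>)
  then show ?thesis
    using assms V_zero_closed unfolding carrier_C by (auto simp: restr_def)
qed

text \<open>A singleton \<open>S\<close> gives the image of one strand of the Tate resolution; an
  interval describes the range allowed for the differential.\<close>

definition strands where
  "strands S = {f \<in> carrier C. \<forall>i j. - int i - j \<notin> S \<longrightarrow> f (i, j) = \<zero>\<^bsub>C\<^esub> (i, j)}"

lemma strands_add:
  assumes "f \<in> strands S" "g \<in> strands S"
  shows "f \<oplus>\<^bsub>C\<^esub> g \<in> strands S"
  using assms C.M.a_closed[of f g] by (auto simp: strands_def) (auto simp: add_C zero_C fun_eq_iff)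

lemma strands_zero: "\<zero>\<^bsub>C\<^esub> \<in> strands S"
  by (simp add: strands_def)

lemma strands_smult: "e \<in> carrier (E_ring n) \<Longrightarrow> f \<in> strands S \<Longrightarrow> e \<odot>\<^bsub>C\<^esub> f \<in> strands S"
  by (auto simp: strands_def C.smult_closed smult_C_component_zero)

text \<open>Only finitely many summands \<open>p\<close> and subsets \<open>I\<close> occur, so
  \<open>f\<close> is a finite sum of terms \<open>v \<otimes> e_I\<close>. The premise for such
  terms is limited to nonzero coordinates of \<open>f\<close>, which lets them remember the strand
  of \<open>f\<close>.\<close>

lemma single_induct:
  assumes f: "f \<in> carrier C" and "P \<zero>\<^bsub>C\<^esub>"
    and add: "\<And>g h. g \<in> carrier C \<Longrightarrow> h \<in> carrier C \<Longrightarrow> P g \<Longrightarrow> P h \<Longrightarrow> P (g \<oplus>\<^bsub>C\<^esub> h)"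
    and single: "\<And>p I. I \<subseteq> {..n} \<Longrightarrow> f p I \<noteq> \<zero>\<^bsub>V p\<^esub> \<Longrightarrow> P (single p I (f p I))"
  shows "P f"
proof -
  have P: "P (restr A f)" if "finite A" for A
    using that
  proof (induction A)
    case empty
    then show ?case using \<open>P \<zero>\<^bsub>C\<^esub>\<close> by (simp add: restr_def zero_C)
  next
    case (insert x A)
    obtain p I where x: "x = (p, I)" by (cases x)
    show ?case
    proof (cases "f p I = \<zero>\<^bsub>V p\<^esub>")
      case True
      then have "restr (insert x A) f = restr A f" by (auto simp: x restr_def fun_eq_iff)
      then show ?thesis using insert by simp
    next
      case False
      then have I: "I \<subseteq> {..n}" using C_outside[OF f] by blast
      have "restr (insert x A) f = single p I (f p I) \<oplus>\<^bsub>C\<^esub> restr A f"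
      proof (intro ext)
        fix q J
        show "restr (insert x A) f q J = (single p I (f p I) \<oplus>\<^bsub>C\<^esub> restr A f) q J"
        proof (cases "q = p \<and> J = I")
          case True
          then show ?thesis
            using insert.hyps(2) I C_component[OF f, of p I] by (simp add: x restr_def add_C single_def)
        next
          case False
          then have "single p I (f p I) q J = \<zero>\<^bsub>V q\<^esub>" "(q, J) \<in> insert x A \<longleftrightarrow> (q, J) \<in> A"
            by (auto simp: x single_def)
          then show ?thesis
            using C_component[OF f, of q J] C_outside[OF f, of J q] by (simp add: restr_def add_C)
        qed
      qed
      then show ?thesis
        using insert I False single_in_C[OF I] C_component[OF f] restr_in_C[OF f] add single by simp
    qed
  qed
  let ?A = "{p. f p \<noteq> (\<lambda>I. \<zero>\<^bsub>V p\<^esub>)} \<times> Pow {..n}"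
  have "finite ?A" using f by (simp add: carrier_C)
  then have "P (restr ?A f)" by (rule P)
  moreover have "restr ?A f = f" using f by (auto simp: restr_def fun_eq_iff carrier_C)
  ultimately show ?thesis by (simp only:)
qed

text \<open>Comparing degrees bounds the image of a generator \<open>v \<otimes> 1\<close>;
  multiplying by \<open>e_I\<close> and adding up reaches every element of the strand.\<close>

lemma degree_minus_one_strands:
  assumes a: "\<forall>i\<le>n. 1 \<le> a i" and D: "graded_E_hom n C C (0, - 1) D" and f: "f \<in> strands {l}"
  shows "D f \<in> strands {l - (\<Sum>i\<le>n. (int (a i) - 1)) - 1 .. l - 1}" (is "_ \<in> strands ?S")
proof -
  have f': "f \<in> carrier C" using f by (simp add: strands_def)
  show ?thesis
  proof (rule single_induct[where P = "\<lambda>f. D f \<in> strands ?S", OF f'])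
    show "D \<zero>\<^bsub>C\<^esub> \<in> strands ?S" by (simp add: graded_E_hom_zero[OF D] C.M.abelian_group_axioms strands_zero)
  next
    fix g h assume "g \<in> carrier C" "h \<in> carrier C" "D g \<in> strands ?S" "D h \<in> strands ?S"
    then show "D (g \<oplus>\<^bsub>C\<^esub> h) \<in> strands ?S"
      using D strands_add by (simp add: graded_E_hom_def)
  next
    fix p I assume I: "I \<subseteq> {..n}" and ne: "f p I \<noteq> \<zero>\<^bsub>V p\<^esub>"
    obtain i j where p: "p = (i, j)" by (cases p)
    have l: "- int i - j = l" using f ne unfolding p strands_def zero_C by force
    let ?v = "single p {} (f p I)"
    have e: "emon I \<in> carrier (E_ring n)" using emon_in_E_deg[OF I] by (auto simp: E_deg_def)
    have v: "?v \<in> grade C ((\<Sum>i\<le>n. int (a i)) + j, int n + 1 - int i)"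
      using single_in_grade C_component[OF f'] p by simp
    then have Dv: "D ?v \<in> grade C ((\<Sum>i\<le>n. int (a i)) + j, int n - int i)"
      using D by (auto simp: graded_E_hom_def image_subset_iff dest!: spec)
    have "D ?v \<in> strands ?S"
    proof -
      have "D ?v (i', j') = \<zero>\<^bsub>C\<^esub> (i', j')" if l': "- int i' - j' \<notin> ?S" for i' j'
      proof (rule ccontr)
        assume "D ?v (i', j') \<noteq> \<zero>\<^bsub>C\<^esub> (i', j')"
        then obtain K where K: "D ?v (i', j') K \<noteq> \<zero>\<^bsub>V (i', j')\<^esub>" by (auto simp: zero_C fun_eq_iff)
        then have K_sub: "K \<subseteq> {..n}" using Dv C_outside[of "D ?v"] by (auto simp only: grade_C)
        have "(\<Sum>i\<in>K. int (a i)) = j' - j" "int (card K) = int i - int i' + 1"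
        proof -
          have "edeg a K = ((\<Sum>i\<le>n. int (a i)) + j - j' - (\<Sum>i\<le>n. int (a i)), int n - int i + int i' - int n - 1)"
            using Dv K unfolding grade_C by blast
          then show "(\<Sum>i\<in>K. int (a i)) = j' - j" "int (card K) = int i - int i' + 1"
            by (simp_all add: edeg_def)
        qed
        \<comment> \<open>The difference of the two degree equations merges the cardinality of
          \<open>K\<close> into the sum; the remaining \<open>1\<close> is the drop in degree under
          \<open>D\<close>.\<close>
        then have "- int i' - j' = l - 1 - (\<Sum>i\<in>K. int (a i) - 1)"
          using l by (simp add: sum_subtractf)
        \<comment> \<open>Positive weights make every summand nonnegative. The bound
          \<open>0\<close> gives the upper end of the interval, and enlarging \<open>K\<close> to
          \<open>{..n}\<close> gives the lower end.\<close>
        moreover have "0 \<le> (\<Sum>i\<in>K. int (a i) - 1)"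
          using K_sub a by (intro sum_nonneg) auto
        moreover have "(\<Sum>i\<in>K. int (a i) - 1) \<le> (\<Sum>i\<le>n. int (a i) - 1)"
          using K_sub a by (intro sum_mono2) auto
        ultimately show False using l' by auto
      qed
      then show ?thesis using Dv by (simp add: strands_def grade_C)
    qed
    \<comment> \<open>Strands depend on the summand and not on the exterior coordinate, so
      multiplication by \<open>e_I\<close> preserves the bound.\<close>
    then have "emon I \<odot>\<^bsub>C\<^esub> D ?v \<in> strands ?S" by (rule strands_smult[OF e])
    also have "emon I \<odot>\<^bsub>C\<^esub> D ?v = D (emon I \<odot>\<^bsub>C\<^esub> ?v)"
      using D e v by (auto simp: graded_E_hom_def grade_C)
    also have "emon I \<odot>\<^bsub>C\<^esub> ?v = single p I (f p I)"
      by (rule emon_smult_single[OF I C_component[OF f']])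
    finally show "D (single p I (f p I)) \<in> strands ?S" .
  qed
qed

text \<open>Vanishing outside \<open>S\<close> is turned into an explicit finite sum of strand
  components, the form demanded by \<open>sum_of_subgroups\<close>.\<close>

lemma strands_decompose:
  assumes S: "finite S" and f: "f \<in> strands S"
  shows "f = finsum C (\<lambda>l. restr ({(i, j). - int i - j = l} \<times> UNIV) f) S" (is "f = finsum C ?c S")
    and "restr ({(i, j). - int i - j = l} \<times> UNIV) f \<in> strands {l}"
proof -
  have f': "f \<in> carrier C" using f by (simp add: strands_def)
  have "finsum C ?c S' = restr ({(i, j). - int i - j \<in> S'} \<times> UNIV) f" if "finite S'" for S'
    using that
  proof (induction S')
    case empty
    then show ?case by (simp add: restr_def zero_C)
  next
    case (insert l S')
    have "finsum C ?c (insert l S') = ?c l \<oplus>\<^bsub>C\<^esub> restr ({(i, j). - int i - j \<in> S'} \<times> UNIV) f"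
      using insert restr_in_C[OF f'] by simp
    also have "\<dots> = restr ({(i, j). - int i - j \<in> insert l S'} \<times> UNIV) f"
    proof (intro ext)
      fix q J
      show "(?c l \<oplus>\<^bsub>C\<^esub> restr ({(i, j). - int i - j \<in> S'} \<times> UNIV) f) q J =
          restr ({(i, j). - int i - j \<in> insert l S'} \<times> UNIV) f q J"
      proof (cases "- int (fst q) - snd q = l")
        case True
        then have "- int (fst q) - snd q \<notin> S'" using insert.hyps(2) by blast
        with True show ?thesis
          using C_component[OF f', of q J] C_outside[OF f', of J q] by (simp add: restr_def add_C split_beta)
      next
        case False
        then show ?thesis
          using C_component[OF f', of q J] C_outside[OF f', of J q] by (simp add: restr_def add_C split_beta)
      qed
    qed
    finally show ?case .
  qed
  moreover have "restr ({(i, j). - int i - j \<in> S} \<times> UNIV) f = f"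
    using f by (auto simp: restr_def strands_def zero_C fun_eq_iff)
  ultimately show "f = finsum C ?c S" using S by simp
  show "restr ({(i, j). - int i - j = l} \<times> UNIV) f \<in> strands {l}"
    unfolding strands_def
  proof (intro CollectI conjI allI impI restr_in_C[OF f'])
    fix i j assume "- int i - j \<notin> {l}"
    then show "restr ({(i, j). - int i - j = l} \<times> UNIV) f (i, j) = \<zero>\<^bsub>C\<^esub> (i, j)"
      unfolding restr_def zero_C by simp
  qed
qed

end

section \<open>The differential of the Tate resolution\<close>

lemma cohomology_E_module_omega_sum:
  "cohomology_E_module n a M = omega_sum n a (\<lambda>(i, j). sheaf_cohomology n a (twist1 j M) i)"
  by (simp add: cohomology_E_module_def omega_sum_def)

lemma module_twist1:
  assumes "Module.module R M"
  shows "Module.module R (twist1 j M)"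
proof -
  interpret Module.module R M by fact
  have "abelian_group (twist1 j M)"
    by (rule abelian_groupI) (auto simp: twist1_def M.a_ac intro: M.l_neg M.a_inv_closed)
  then show ?thesis
    by (intro moduleI) (auto simp: twist1_def R.is_cring smult_l_distr smult_r_distr smult_assoc1)
qed

text \<open>The graded module structure on the direct sum first makes each cohomology group abelian;
  with this, \<open>cech_cohomology_smult\<close> supplies the two scalar laws.\<close>

lemma omega_sum_module_cohomology:
  assumes M: "graded_S_module n a M" and graded: "graded_E_module n a (cohomology_E_module n a M)"
  shows "omega_sum_unital n a (\<lambda>(i, j). sheaf_cohomology n a (twist1 j M) i)"
proof -
  let ?V = "\<lambda>(i, j). sheaf_cohomology n a (twist1 j M) i"
  interpret omega_sum_module n a ?V
    using graded by (simp add: omega_sum_module_def cohomology_E_module_omega_sum)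
  have mod: "Module.module (S_ring n) (twist1 j M)" for j
    using M by (simp add: graded_S_module_def module_twist1)
  have gr: "grade (twist1 j M) d \<subseteq> carrier (twist1 j M)" for j d
    using M internal_direct_sum_subgroup[of M "grade M", THEN subgroup.subset]
    by (simp add: graded_S_module_def twist1_def)
  show ?thesis
  proof
    fix p v assume v: "v \<in> carrier (?V p)"
    obtain i j where p: "p = (i, j)" by (cases p)
    \<comment> \<open>Sheaf cohomology in degree \<open>i\<close> is carried by index sets with
      \<open>Suc i\<close> elements, and the twist by \<open>j\<close> is moved into the module,
      leaving internal degree \<open>0\<close>.\<close>
    note smult = cech_cohomology_smult[OF mod gr, of "Pow {..n} - {{}}" a j "Suc i" 0,
        folded sheaf_cohomology_def]
    have "abelian_group (sheaf_cohomology n a (twist1 j M) i)"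
      using V.abelian_group_axioms[of p] by (simp add: p)
    with v show "1 \<odot>\<^bsub>?V p\<^esub> v = v" "0 \<odot>\<^bsub>?V p\<^esub> v = \<zero>\<^bsub>?V p\<^esub>"
      using smult by (simp_all add: p)
  qed
qed

theorem lemma4p4:
  fixes n :: nat and a :: "nat \<Rightarrow> nat"
    and M :: "('k::field mpoly, 'm, int) graded"
    and T :: "('k, (int \<Rightarrow> nat set \<Rightarrow> 'm) \<times> 'f) diff_mod"
    and \<phi> :: "(int \<Rightarrow> nat set \<Rightarrow> 'm) \<times> 'f
      \<Rightarrow> nat \<times> int \<Rightarrow> nat set \<Rightarrow> (nat set \<Rightarrow> ('m \<times> nat) set) set"
    and l :: int
  assumes "\<forall>i\<le>n. 1 \<le> a i" and "\<forall>i j. i \<le> j \<and> j \<le> n \<longrightarrow> a i \<le> a j"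
    and "graded_S_module n a M" and "fin_gen (S_ring n) M"
    and "is_tate_resolution n a M T"
    and "graded_E_iso n a T (cohomology_E_module n a M) \<phi>"
  shows "diff T ` tate_strand n a M T \<phi> l
    \<subseteq> sum_of_subgroups T {l - (\<Sum>i\<le>n. (int (a i) - 1)) - 1 .. l - 1} (tate_strand n a M T \<phi>)"
proof
  let ?V = "\<lambda>(i, j). sheaf_cohomology n a (twist1 j M) i"
  let ?S = "{l - (\<Sum>i\<le>n. (int (a i) - 1)) - 1 .. l - 1}"
  let ?\<psi> = "inv_into (carrier T) \<phi>"
  have T: "graded_E_module n a T" and graded: "graded_E_module n a (cohomology_E_module n a M)"
    and \<phi>: "graded_E_hom n T (cohomology_E_module n a M) (0, 0) \<phi>"
    and bij: "bij_betw \<phi> (carrier T) (carrier (cohomology_E_module n a M))"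
    using assms(6) by (auto simp: graded_E_iso_def)
  interpret omega_sum_unital n a ?V
    by (rule omega_sum_module_cohomology[OF assms(3) graded])
  have C: "cohomology_E_module n a M = C" by (rule cohomology_E_module_omega_sum)
  interpret T: right_module "E_ring n" T using T by (simp add: graded_E_module_def)
  have dT: "graded_E_hom n T T (0, - 1) (diff T)"
    using assms(5) cone_diff_hom
    unfolding is_tate_resolution_def minimal_free_flag_resolution_def free_flag_def quasi_isomorphism_def
    by blast
  note \<phi> = \<phi>[unfolded C] and bij = bij[unfolded C]
  have \<psi>: "graded_E_hom n C T (0, 0) ?\<psi>" using graded_E_iso_inv[OF assms(6)] by (simp only: C)
  have \<psi>\<phi>: "?\<psi> (\<phi> t) = t" if "t \<in> carrier T" for t
    using bij that by (simp add: bij_betw_def)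
  have \<phi>\<psi>: "\<phi> (?\<psi> g) = g" "?\<psi> g \<in> carrier T" if "g \<in> carrier C" for g
    using bij that by (auto simp: bij_betw_def f_inv_into_f inv_into_into)
  \<comment> \<open>The strands of \<open>T\<close> are the preimages under \<open>\<phi>\<close> of
    those of the direct sum.\<close>
  have strand: "tate_strand n a M T \<phi> l' = {t \<in> carrier T. \<phi> t \<in> strands {l'}}" for l'
    using \<phi> by (auto simp: tate_strand_def strands_def C graded_E_hom_def)
  fix y assume "y \<in> diff T ` tate_strand n a M T \<phi> l"
  then obtain x where x: "x \<in> carrier T" "\<phi> x \<in> strands {l}" and y: "y = diff T x"
    by (auto simp: strand)
  have yT: "y \<in> carrier T" using dT x y by (auto simp: graded_E_hom_def)
  \<comment> \<open>Conjugating the differential by the identification gives an endomorphism of the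
    direct sum of the same degree, to which the degree count applies.\<close>
  have D: "graded_E_hom n C C (0, - 1) (\<phi> \<circ> (diff T \<circ> ?\<psi>))"
    using graded_E_hom_comp[OF graded_E_hom_comp[OF \<psi> dT] \<phi>] by simp
  from degree_minus_one_strands[OF assms(1) this x(2)] have \<phi>y: "\<phi> y \<in> strands ?S"
    using x by (simp add: y \<psi>\<phi>)
  let ?c = "\<lambda>l'. restr ({(i, j). - int i - j = l'} \<times> UNIV) (\<phi> y)"
  have c: "?c l' \<in> strands {l'}" for l'
    using strands_decompose(2)[OF _ \<phi>y] by simp
  then have c_C: "?c l' \<in> carrier C" for l' by (simp add: strands_def)
  \<comment> \<open>The strand components of \<open>\<phi> y\<close> are pulled back one at a time,
    giving the summands of \<open>y\<close> in \<open>T\<close>.\<close>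
  have "y = ?\<psi> (finsum C ?c ?S)"
    using strands_decompose(1)[OF _ \<phi>y] \<psi>\<phi>[OF yT] by simp
  also have "\<dots> = finsum T (\<lambda>l'. ?\<psi> (?c l')) ?S"
    using c_C by (intro graded_E_hom_finsum[OF \<psi> C.M.abelian_group_axioms T.M.abelian_group_axioms]) auto
  finally have "y = finsum T (\<lambda>l'. ?\<psi> (?c l')) ?S" .
  moreover have "?\<psi> (?c l') \<in> tate_strand n a M T \<phi> l'" for l'
    unfolding strand using c c_C \<phi>\<psi> by simp
  ultimately show "y \<in> sum_of_subgroups T ?S (tate_strand n a M T \<phi>)"
    unfolding sum_of_subgroups_def by blast
qed

end
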